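(* Let $p\in(0,1)$. The $p$-quantile $m_p$ has an asymptotic expansion at infinity: there are real numbers $\tau_n$, $n\geq -2$ (depending on $p$), such that $$m_p(x)\sim \sum_{n=-2}^{\infty}\frac{\tau_n}{x^{n/2}}=x-L_p\,x^{1/2}+\frac{L_p^2-1}{3}+\frac{L_p(7-L_p^2)}{36}\,x^{-1/2}+\ldots,\quad x\to\infty,$$ that is, $\tau_{-2}=1$, $\tau_{-1}=-L_p$, $\tau_0=\frac{L_p^2-1}{3}$ and $\tau_1=\frac{L_p(7-L_p^2)}{36}$.
   Context: For $p\in(0,1)$ and $x>0$, $m_p(x)>0$ denotes the $p$-quantile of the gamma distribution with shape parameter $x$ and scale parameter $1$, i.e. the unique positive number with $\int_0^{m_p(x)}e^{-t}t^{x-1}\,dt=p\,\Gamma(x)$. $L_p\in\mathbb R$ denotes the $(1-p)$-quantile of the standard Gaussian distribution, i.e. $\int_0^{L_p}e^{-s^2/2}\,ds=(1-2p)\sqrt{\pi/2}$. The notation $f(x)\sim\sum_{n=n_0}^\infty \beta_n/x^{n/2}$ as $x\to\infty$ means that for every $N\geq n_0$, $f(x)-\sum_{n=n_0}^N\beta_n/x^{n/2}=O(x^{-(N+1)/2})$ as $x\to\infty$. *)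

theory Defs
  imports "HOL-Probability.Probability" "HOL-Library.Landau_Symbols"
begin

definition is_gamma_quantile :: "real \<Rightarrow> real \<Rightarrow> real \<Rightarrow> bool" where
  "is_gamma_quantile p x m \<longleftrightarrow>
     m > 0 \<and> (LBINT t=0..m. exp (- t) * t powr (x - 1)) = p * Gamma x"

definition gamma_quantile :: "real \<Rightarrow> real \<Rightarrow> real" where
  "gamma_quantile p x = (THE m. is_gamma_quantile p x m)"

text \<open>The interval integral is oriented, so negative values of \<open>L\<close> (that is, \<open>p > 1/2\<close>) are covered.\<close>

definition is_gauss_upper_quantile :: "real \<Rightarrow> real \<Rightarrow> bool" where
  "is_gauss_upper_quantile p L \<longleftrightarrow>
     (LBINT s=0..L. exp (- s\<^sup>2 / 2)) = (1 - 2 * p) * sqrt (pi / 2)"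

definition gauss_upper_quantile :: "real \<Rightarrow> real" where
  "gauss_upper_quantile p = (THE L. is_gauss_upper_quantile p L)"

definition has_half_power_expansion :: "(real \<Rightarrow> real) \<Rightarrow> int \<Rightarrow> (int \<Rightarrow> real) \<Rightarrow> bool" where
  "has_half_power_expansion f n0 \<beta> \<longleftrightarrow>
     (\<forall>N\<ge>n0. (\<lambda>x. f x - (\<Sum>n=n0..N. \<beta> n / x powr (of_int n / 2)))
                \<in> O[at_top](\<lambda>x. x powr (- (of_int N + 1) / 2)))"



text \<open>The two quantiles exist and are unique, so the definite descriptions above denote.\<close>

lemma LBINT_mono_ex1:
  fixes f :: "real \<Rightarrow> real"
  assumes int: "set_integrable lborel {0..} f"
    and cont: "continuous_on {0<..} f"
    and nonneg: "0 \<le> f 0"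
    and pos: "\<And>t. 0 < t \<Longrightarrow> 0 < f t"
    and c: "0 < c" "c < (LBINT t:{0..}. f t)"
  shows "\<exists>!m. (0::real) < m \<and> (LBINT t=0..m. f t) = c"
proof -
  define F where "F m = integral {0..m} f" for m
  have intm: "set_integrable lborel {a..b} f" if "0 \<le> a" for a b
    by (rule set_integrable_subset[OF int]) (use that in auto)
  have F: "(LBINT t=0..m. f t) = F m" if "0 \<le> m" for m :: real
    unfolding F_def zero_ereal_def
    by (rule interval_integral_eq_integral) (use that intm in auto)
  have hk: "f integrable_on {a..b}" if "0 \<le> a" for a b
    using set_borel_integral_eq_integral(1)[OF intm[OF that]] .
  have nn: "0 \<le> f t" if "0 \<le> t" for t
    using that nonneg pos[of t] by (cases "t = 0") auto
  have mono: "F a < F b" if "0 \<le> a" "a < b" for a b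
  proof -
    have "F b = F a + integral {a..b} f"
      unfolding F_def using that by (intro Henstock_Kurzweil_Integration.integral_combine[symmetric] hk) auto
    moreover have "integral {a..b} f > 0"
    proof -
      define d where "d = (a + b) / 2"
      have d: "a < d" "d < b" using that by (auto simp: d_def)
      have "integral {a..b} f = integral {a..d} f + integral {d..b} f"
        using that d by (intro Henstock_Kurzweil_Integration.integral_combine[symmetric] hk) auto
      moreover have "integral {a..d} f \<ge> 0"
        using that by (intro Henstock_Kurzweil_Integration.integral_nonneg hk nn) auto
      moreover have "integral {d..b} (\<lambda>_. 0) < integral {d..b} f"
        using that d by (intro integral_less_real continuous_on_subset[OF cont] pos) auto
      ultimately show ?thesis by simp
    qed
    ultimately show ?thesis by simp
  qed
  have lim: "(F \<longlongrightarrow> (LBINT t:{0..}. f t)) at_top"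
  proof -
    have "((\<lambda>y. \<integral>x. indicator {..y} x *\<^sub>R (indicator {0..} x *\<^sub>R f x) \<partial>lborel)
             \<longlongrightarrow> (LBINT t:{0..}. f t)) at_top"
      unfolding set_lebesgue_integral_def
      by (rule tendsto_integral_at_top) (use int in \<open>auto simp: set_integrable_def\<close>)
    moreover have "(\<integral>x. indicator {..y} x *\<^sub>R (indicator {0..} x *\<^sub>R f x) \<partial>lborel) = F y" for y
    proof -
      have "(\<integral>x. indicator {..y} x *\<^sub>R (indicator {0..} x *\<^sub>R f x) \<partial>lborel) = (LBINT t:{0..y}. f t)"
        unfolding set_lebesgue_integral_def
        by (rule Bochner_Integration.integral_cong) (auto simp: indicator_def)
      also have "\<dots> = F y" unfolding F_def
        by (rule set_borel_integral_eq_integral(2)[OF intm]) simp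
      finally show ?thesis .
    qed
    ultimately show ?thesis by simp
  qed
  obtain b where b: "0 < b" "c < F b"
  proof -
    have "eventually (\<lambda>y. c < F y \<and> 0 < y) at_top"
      using order_tendstoD(1)[OF lim c(2)] eventually_gt_at_top[of 0]
      by eventually_elim auto
    then show ?thesis using that by (auto dest: eventually_happens)
  qed
  have "continuous_on {0..b} F"
    unfolding F_def by (rule indefinite_integral_continuous_1) (use hk in auto)
  moreover have F0: "F 0 = 0" by (simp add: F_def)
  ultimately obtain m where m: "0 \<le> m" "F m = c"
    using IVT'[of F 0 c b] b c by auto
  have "m > 0" using m F0 c(1) by (cases "m = 0") auto
  show ?thesis
  proof (rule ex1I[of _ m])
    show "(0::real) < m \<and> (LBINT t=0..m. f t) = c" using m \<open>m > 0\<close> F by auto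
    fix m' assume "(0::real) < m' \<and> (LBINT t=0..m'. f t) = c"
    then have "0 < m'" "F m' = F m" using F m by auto
    then show "m' = m" using mono \<open>m > 0\<close>
      by (metis less_eq_real_def linorder_neqE_linordered_idom order_less_irrefl)
  qed
qed

lemma ex1_gamma_quantile:
  assumes "0 < p" "p < 1" "0 < x"
  shows "\<exists>!m. is_gamma_quantile p x m"
proof -
  have eq: "(\<lambda>t::real. t powr (x - 1) / exp t) = (\<lambda>t. exp (- t) * t powr (x - 1))"
    by (auto simp: exp_minus field_simps)
  have hi: "((\<lambda>t. exp (- t) * t powr (x - 1)) has_integral Gamma x) {0..}"
    using Gamma_integral_real[OF assms(3)] eq by simp
  have "set_integrable lebesgue {0..} (\<lambda>t. exp (- t) * t powr (x - 1))"
    by (rule nonnegative_absolutely_integrable_1) (use hi in \<open>auto simp: has_integral_iff\<close>)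
  then have int: "set_integrable lborel {0..} (\<lambda>t::real. exp (- t) * t powr (x - 1))"
    unfolding set_integrable_def by (subst (asm) integrable_completion) auto
  moreover have "(LBINT t:{0..}. exp (- t) * t powr (x - 1)) = Gamma x"
    using set_borel_integral_eq_integral(2)[OF int] hi by (simp add: integral_unique)
  moreover have "Gamma x > 0" using assms by (rule_tac Gamma_real_pos)
  ultimately show ?thesis unfolding is_gamma_quantile_def
    using assms by (intro LBINT_mono_ex1) (auto intro!: continuous_intros)
qed

lemma ex1_gauss_upper_quantile:
  assumes "0 < p" "p < 1"
  shows "\<exists>!L. is_gauss_upper_quantile p L"
proof -
  let ?g = "\<lambda>s::real. exp (- s\<^sup>2 / 2)"
  define G where "G L = (LBINT s=0..L. ?g s)" for L :: real
  have hb: "has_bochner_integral lborel (\<lambda>x. indicator {0..} x *\<^sub>R ?g x) (sqrt (pi / 2))"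
  proof -
    have *: "has_bochner_integral lborel (\<lambda>x. indicator {0..} (0 + (1 / sqrt 2) * x) *\<^sub>R exp (- (0 + (1 / sqrt 2) * x)\<^sup>2))
            ((sqrt pi / 2) /\<^sub>R \<bar>1 / sqrt 2\<bar>)"
      using gaussian_moment_0
      by (subst (asm) lborel_has_bochner_integral_real_affine_iff[where c = "1 / sqrt 2" and t = 0]) auto
    have 1: "(\<lambda>x. indicator {0..} (0 + (1 / sqrt 2) * x) *\<^sub>R exp (- (0 + (1 / sqrt 2) * x)\<^sup>2)) = (\<lambda>x. indicator {0..} x *\<^sub>R ?g x)"
      by (rule ext) (auto simp: indicator_def power_divide zero_le_divide_iff)
    have 2: "(sqrt pi / 2) /\<^sub>R \<bar>1 / sqrt 2\<bar> = sqrt (pi / 2)"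
      by (simp add: real_sqrt_divide field_simps)
    show ?thesis using * unfolding 1 2 .
  qed
  have int: "set_integrable lborel {0..} ?g" and val: "(LBINT s:{0..}. ?g s) = sqrt (pi / 2)"
    using hb by (auto simp: set_integrable_def set_lebesgue_integral_def has_bochner_integral_iff)
  have ex1: "\<exists>!m. 0 < m \<and> G m = c" if "0 < c" "c < sqrt (pi / 2)" for c
    unfolding G_def using that int val by (intro LBINT_mono_ex1) (auto intro!: continuous_intros)
  have odd: "G (- L) = - G L" for L
  proof -
    have "G (- L) = (LBINT s=-ereal (-L)..-0. ?g (- s))"
      unfolding G_def by (subst interval_integral_endpoints_reverse, subst interval_integral_reflect) 
        (simp add: interval_integral_endpoints_reverse[of "ereal L" 0])
    then show ?thesis unfolding G_def
      by (simp add: interval_integral_endpoints_reverse[of "ereal L" 0])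
  qed
  have G0: "G 0 = 0" by (simp add: G_def zero_ereal_def[symmetric])
  have Gpos: "G L > 0" if "L > 0" for L
  proof -
    have i: "set_integrable lborel {0..L} ?g"
      by (rule set_integrable_subset[OF int]) auto
    have "G L = integral {0..L} ?g" unfolding G_def zero_ereal_def
      by (rule interval_integral_eq_integral) (use that i in auto)
    also have "\<dots> > 0"
      using integral_less_real[of 0 L "\<lambda>_. 0" ?g] that by (simp add: continuous_intros)
    finally show ?thesis .
  qed
  have key: "\<exists>!L. G L = c" if c: "\<bar>c\<bar> < sqrt (pi / 2)" for c
  proof (cases c "0 :: real" rule: linorder_cases)
    case equal
    have "L = 0" if "G L = 0" for L
      using Gpos[of L] Gpos[of "- L"] odd[of L] that by fastforce
    then show ?thesis using G0 equal by (intro ex1I[of _ 0]) auto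
  next
    case greater
    obtain m where m: "0 < m" "G m = c" and uniq: "\<And>m'. 0 < m' \<Longrightarrow> G m' = c \<Longrightarrow> m' = m"
    proof -
      have "c < sqrt (pi / 2)" using c by linarith
      from ex1[OF greater this] show ?thesis by (elim ex1E) (rule that, blast+)
    qed
    have pos: "0 < L" if "G L = c" for L
      using Gpos[of "- L"] odd[of L] that greater G0
      by (cases "L = 0"; cases "L < 0"; simp)
    show ?thesis
      by (rule ex1I[of _ m], rule m(2), rule uniq, rule pos)
  next
    case less
    obtain m where m: "0 < m" "G m = - c" and uniq: "\<And>m'. 0 < m' \<Longrightarrow> G m' = - c \<Longrightarrow> m' = m"
    proof -
      have "0 < - c" "- c < sqrt (pi / 2)" using c less by linarith+
      from ex1[OF this] show ?thesis by (elim ex1E) (rule that, blast+)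
    qed
    have neg: "L < 0" if "G L = c" for L
      using Gpos[of L] that less G0
      by (cases "L = 0"; cases "L < 0"; simp)
    show ?thesis
    proof (rule ex1I[of _ "- m"])
      show "G (- m) = c" using m odd by simp
      fix L assume L: "G L = c"
      have "- L = m" by (rule uniq) (use neg[OF L] odd[of L] L in simp_all)
      then show "L = - m" by simp
    qed
  qed
  have "\<bar>(1 - 2 * p) * sqrt (pi / 2)\<bar> < sqrt (pi / 2)"
  proof -
    have "\<bar>1 - 2 * p\<bar> < 1" using assms by (auto simp: abs_if)
    then have "\<bar>1 - 2 * p\<bar> * sqrt (pi / 2) < 1 * sqrt (pi / 2)"
      by (intro mult_strict_right_mono) auto
    then show ?thesis by (simp add: abs_mult)
  qed
  from key[OF this] show ?thesis by (simp add: is_gauss_upper_quantile_def G_def)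
qed

lemma is_gamma_quantile_gamma_quantile:
  "0 < p \<Longrightarrow> p < 1 \<Longrightarrow> 0 < x \<Longrightarrow> is_gamma_quantile p x (gamma_quantile p x)"
  unfolding gamma_quantile_def by (rule theI') (rule ex1_gamma_quantile)

lemma is_gauss_upper_quantile_gauss_upper_quantile:
  "0 < p \<Longrightarrow> p < 1 \<Longrightarrow> is_gauss_upper_quantile p (gauss_upper_quantile p)"
  unfolding gauss_upper_quantile_def by (rule theI') (rule ex1_gauss_upper_quantile)

end

theory Submission
  imports Defs "HOL-Real_Asymp.Real_Asymp"
begin

text \<open>
  Write \<open>x = 1 / \<epsilon>\<^sup>2\<close> and measure a point \<open>t = x (1 + w)\<close> by the coordinate \<open>y = \<eta> w / \<epsilon>\<close>, where
  \<open>\<eta> w\<close> is the square root of \<open>2 (w - ln (1 + w))\<close> carrying the sign of \<open>w\<close>. Then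
  \<open>exp (-t) t powr (x - 1) dt\<close> becomes, up to a constant depending on \<open>x\<close> only, the measure
  \<open>exp (-y\<^sup>2/2) g (\<epsilon> y) dy\<close> on the whole line, with \<open>g (\<eta> w) = \<eta> w / w\<close> (\<open>gamma_substitution\<close>). So the
  coordinate \<open>Y \<epsilon>\<close> of the quantile (\<open>scaled_quantile\<close>) satisfies
  \<open>\<integral>\<^bsub>-\<infinity>\<^esub>\<^bsup>Y\<^esup> exp (-y\<^sup>2/2) g (\<epsilon> y) dy = p \<integral>\<^bsub>-\<infinity>\<^esub>\<^bsup>\<infinity>\<^esup> exp (-y\<^sup>2/2) g (\<epsilon> y) dy\<close>.

  The function \<open>g\<close> differs from its Taylor polynomials by at most a constant times a power of \<open>\<bar>y\<bar>\<close> on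
  the whole line (\<open>weight_global_bound\<close>), and Gaussian moments are finite. Hence the
  equation may be truncated at any order in \<open>\<epsilon>\<close>; it then only involves the partial moments
  of the Gaussian (\<open>truncated_quantile_equation\<close>). Its leading term says that \<open>Y\<close> tends to \<open>- L\<close>. In every
  other term a positive power of \<open>\<epsilon>\<close> is available, so an expansion of \<open>Y\<close> of order \<open>n\<close> determines all of
  these to order \<open>n + 1\<close>, and inverting the smooth function \<open>y \<mapsto> \<integral>\<^bsub>-\<infinity>\<^esub>\<^bsup>y\<^esup> exp (-s\<^sup>2/2) ds\<close> near \<open>- L\<close> gives \<open>Y\<close> to
  order \<open>n + 1\<close> (\<open>expands_scaled_quantile_step\<close>). Finally the quantile is \<open>x (1 + \<eta>\<inverse> (\<epsilon> Y \<epsilon>))\<close>.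

  The four coefficients follow from \<open>g y = 1 - y/3 + y\<^sup>2/12 + \<dots>\<close>, which gives
  \<open>Y = - L - \<epsilon>/3 - L \<epsilon>\<^sup>2/36 + \<dots>\<close> (\<open>expands_scaled_quantile_3\<close>), and from
  \<open>\<eta>\<inverse> y = y + y\<^sup>2/3 + y\<^sup>3/36 + \<dots>\<close>.
\<close>

section \<open>Expansions in powers at zero\<close>

text \<open>Only the class of the polynomial modulo \<open>h ^ n\<close> matters. Using polynomials instead of lists of
  coefficients makes products and compositions of expansions literally products and compositions of
  polynomials; \<open>agree n\<close> is equality modulo \<open>h ^ n\<close>.\<close>

definition expands :: "real filter \<Rightarrow> nat \<Rightarrow> (real \<Rightarrow> real) \<Rightarrow> real poly \<Rightarrow> bool" where
  "expands F n f p \<longleftrightarrow> (\<lambda>h. f h - poly p h) \<in> O[F](\<lambda>h. h ^ n)"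

definition agree :: "nat \<Rightarrow> real poly \<Rightarrow> real poly \<Rightarrow> bool" where
  "agree n p q \<longleftrightarrow> (\<forall>k<n. coeff p k = coeff q k)"

lemma nhds_0_refl: "nhds (0::real) \<le> nhds 0" by simp

lemma at_right_0_le_nhds: "at_right 0 \<le> nhds (0::real)"
  by (simp add: at_within_def)

lemma power_bigo_power:
  assumes "F \<le> nhds (0::real)" "m \<le> n"
  shows "(\<lambda>h. h ^ n) \<in> O[F](\<lambda>h. h ^ m)"
proof (rule bigoI[where c = 1])
  have "\<forall>\<^sub>F h in nhds (0::real). \<bar>h\<bar> < 1"
    using eventually_nhds_metric[of "\<lambda>h. \<bar>h\<bar> < 1" "0::real"] by (auto simp: dist_norm intro!: exI[of _ 1])
  then have "\<forall>\<^sub>F h in F. \<bar>h\<bar> < 1" using assms(1) by (auto simp: le_filter_def)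
  then show "\<forall>\<^sub>F h in F. norm (h ^ n) \<le> 1 * norm (h ^ m)"
    by eventually_elim (use assms(2) in \<open>auto simp: power_abs intro!: power_decreasing\<close>)
qed

lemma bigo_diff_trans:
  fixes a b c g :: "real \<Rightarrow> real"
  assumes "(\<lambda>h. a h - b h) \<in> O[F](g)" "(\<lambda>h. b h - c h) \<in> O[F](g)"
  shows "(\<lambda>h. a h - c h) \<in> O[F](g)"
proof -
  have "(\<lambda>h. (a h - b h) + (b h - c h)) \<in> O[F](g)" by (rule sum_in_bigo(1)[OF assms])
  then show ?thesis by (simp only: diff_add_cancel add_diff_eq)
qed

lemma bigo_tendsto_0:
  fixes f g :: "real \<Rightarrow> real"
  assumes "f \<in> O[F](g)" and "(g \<longlongrightarrow> 0) F"
  shows "(f \<longlongrightarrow> 0) F"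
proof -
  obtain c where c: "\<forall>\<^sub>F x in F. norm (f x) \<le> c * norm (g x)" using assms(1) by (elim landau_o.bigE)
  have "((\<lambda>x. c * norm (g x)) \<longlongrightarrow> c * norm (0::real)) F" by (intro tendsto_intros assms(2))
  then show ?thesis using c by (intro Lim_null_comparison[of f "\<lambda>x. c * norm (g x)"]) simp_all
qed

lemma poly_bigo_1:
  assumes "F \<le> nhds (0::real)"
  shows "poly p \<in> O[F](\<lambda>_. 1)"
proof -
  have "(poly p \<longlongrightarrow> poly p 0) F"
    using isCont_def continuous_at_imp_continuous_at_within
    by (rule_tac tendsto_mono[OF assms]) (auto simp: tendsto_at_iff_tendsto_nhds[symmetric] isCont_def[symmetric])
  then have "\<forall>\<^sub>F h in F. dist (poly p h) (poly p 0) < 1" by (rule tendstoD) simp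
  then show ?thesis
    by (intro bigoI[where c = "\<bar>poly p 0\<bar> + 1"]) (auto simp: dist_real_def elim!: eventually_mono)
qed

lemma agree_bigo:
  assumes "F \<le> nhds (0::real)" "agree n p q"
  shows "(\<lambda>h. poly p h - poly q h) \<in> O[F](\<lambda>h. h ^ n)"
proof -
  have "monom 1 n dvd p - q" using assms(2) by (simp add: monom_1_dvd_iff' agree_def)
  then obtain r where r: "p - q = monom 1 n * r" by (elim dvdE)
  have "poly p h - poly q h = h ^ n * poly r h" for h
    using arg_cong[OF r, of "\<lambda>s. poly s h"] by (simp add: poly_monom)
  then show ?thesis
    using landau_o.big.mult[OF landau_o.big_refl[of "\<lambda>h. h ^ n" F] poly_bigo_1[OF assms(1), of r]] by simp
qed

text \<open>Coefficients can be read off one at a time from a one-sided limit at zero, which is why a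
  one-sided expansion already determines its coefficients.\<close>

lemma bigo_power_coeff_0:
  assumes "poly r \<in> O[at_right 0](\<lambda>h. h ^ n)" "k < n"
  shows "coeff r k = (0::real)"
  using assms
proof (induction n arbitrary: r k)
  case (Suc n)
  obtain a r' where r: "r = pCons a r'" by (cases r)
  have "(poly r \<longlongrightarrow> a) (at_right 0)"
  proof -
    have "(poly r \<longlongrightarrow> poly r 0) (at_right 0)" by (intro tendsto_intros)
    then show ?thesis by (simp add: r)
  qed
  moreover have "((\<lambda>h::real. h ^ Suc n) \<longlongrightarrow> 0) (at_right 0)"
  proof -
    have "((\<lambda>h::real. h ^ Suc n) \<longlongrightarrow> 0 ^ Suc n) (at_right 0)" by (intro tendsto_intros)
    then show ?thesis by simp
  qed
  from Suc.prems(1) this have "(poly r \<longlongrightarrow> 0) (at_right 0)"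
    by (rule bigo_tendsto_0)
  ultimately have a: "a = 0"
    by (intro tendsto_unique[of "at_right (0::real)"]) auto
  have "(\<lambda>h. h * poly r' h) \<in> O[at_right 0](\<lambda>h. h * h ^ n)"
    using Suc.prems(1) by (simp add: r a)
  then have "poly r' \<in> O[at_right 0](\<lambda>h. h ^ n)"
    by (subst (asm) landau_o.big.mult_cancel_left) (auto simp: eventually_at_filter)
  from Suc.IH[OF this] show ?case
    using Suc.prems(2) by (cases k) (auto simp: r a)
next
  case 0
  from 0(2) show ?case by simp
qed

context
  fixes F :: "real filter"
  assumes F: "F \<le> nhds 0"
begin

lemma expands_poly: "expands F n (poly p) p"
  by (simp add: expands_def)

lemma expands_const: "expands F n (\<lambda>_. c) [:c:]"
  by (simp add: expands_def)

lemma expands_id: "expands F n (\<lambda>h. h) [:0, 1:]"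
  by (simp add: expands_def)

lemma expands_mono: "expands F n f p \<Longrightarrow> m \<le> n \<Longrightarrow> expands F m f p"
  unfolding expands_def using landau_o.big_trans power_bigo_power[OF F] by blast

lemma expands_agree: "expands F n f p \<Longrightarrow> agree n p q \<Longrightarrow> expands F n f q"
  unfolding expands_def by (rule bigo_diff_trans[OF _ agree_bigo[OF F]])

lemma expands_add: "expands F n f p \<Longrightarrow> expands F n g q \<Longrightarrow> expands F n (\<lambda>h. f h + g h) (p + q)"
  unfolding expands_def by (drule (1) sum_in_bigo(1)) (simp add: algebra_simps)

lemma expands_diff: "expands F n f p \<Longrightarrow> expands F n g q \<Longrightarrow> expands F n (\<lambda>h. f h - g h) (p - q)"
  unfolding expands_def by (drule (1) sum_in_bigo(2)) (simp add: algebra_simps)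

lemma expands_bigo_1:
  assumes "expands F n f p"
  shows "f \<in> O[F](\<lambda>_. 1)"
proof -
  have "(\<lambda>h. f h - poly p h) \<in> O[F](\<lambda>_. 1)"
    using expands_mono[OF assms, of 0] by (simp add: expands_def)
  from sum_in_bigo(1)[OF this poly_bigo_1[OF F, of p]] show ?thesis by simp
qed

lemma expands_mult:
  assumes "expands F n f p" "expands F n g q"
  shows "expands F n (\<lambda>h. f h * g h) (p * q)"
proof -
  have "(\<lambda>h. f h * (g h - poly q h)) \<in> O[F](\<lambda>h. 1 * h ^ n)"
    using assms by (intro landau_o.big.mult expands_bigo_1[OF assms(1)]) (simp add: expands_def)
  moreover have "(\<lambda>h. (f h - poly p h) * poly q h) \<in> O[F](\<lambda>h. h ^ n * 1)"
    using assms by (intro landau_o.big.mult poly_bigo_1[OF F]) (simp add: expands_def)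
  ultimately have "(\<lambda>h. f h * (g h - poly q h) + (f h - poly p h) * poly q h) \<in> O[F](\<lambda>h. h ^ n)"
    by (intro sum_in_bigo) auto
  then show ?thesis by (simp add: expands_def algebra_simps)
qed

lemma expands_sum:
  "(\<And>i. i \<in> A \<Longrightarrow> expands F n (f i) (p i)) \<Longrightarrow> expands F n (\<lambda>h. \<Sum>i\<in>A. f i h) (\<Sum>i\<in>A. p i)"
proof (induction A rule: infinite_finite_induct)
  case (insert x A)
  then show ?case by (simp add: expands_add)
qed (simp_all add: expands_def)

lemma expands_shift:
  assumes "expands F n f p"
  shows "expands F (n + k) (\<lambda>h. h ^ k * f h) (monom 1 k * p)"
proof -
  have "(\<lambda>h. h ^ k * (f h - poly p h)) \<in> O[F](\<lambda>h. h ^ k * h ^ n)"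
    using assms by (intro landau_o.big.mult) (auto simp: expands_def)
  then show ?thesis by (simp add: expands_def poly_monom algebra_simps power_add)
qed

lemma expands_poly_compose:
  assumes "expands F n f q"
  shows "expands F n (\<lambda>h. poly p (f h)) (pcompose p q)"
proof (induction p)
  case (pCons a p)
  show ?case using expands_add[OF expands_const expands_mult[OF assms pCons.IH]]
    by (simp add: pcompose_pCons)
qed (simp add: expands_def)

lemma expands_bigo_id:
  assumes "expands F n f q" "coeff q 0 = 0" "n \<ge> 1"
  shows "f \<in> O[F](\<lambda>h. h)"
proof -
  have "expands F 1 f 0"
    by (rule expands_agree[OF expands_mono[OF assms(1,3)]]) (use assms(2) in \<open>simp add: agree_def\<close>)
  then show ?thesis by (simp only: expands_def poly_0 diff_zero power_one_right)
qed

text \<open>The outer expansion is evaluated at a function that is \<open>O(h)\<close>, so its error \<open>O(f h ^ n)\<close>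
  is \<open>O(h ^ n)\<close>; what remains is a polynomial in \<open>f\<close>.\<close>

lemma expands_compose:
  assumes g: "expands (nhds 0) n g p" and f: "expands F n f q" "coeff q 0 = 0" "n \<ge> 1"
  shows "expands F n (\<lambda>h. g (f h)) (pcompose p q)"
proof -
  have fO: "f \<in> O[F](\<lambda>h. h)" by (rule expands_bigo_id[OF f])
  have "((\<lambda>h. h) \<longlongrightarrow> 0) F" using F by (simp add: filterlim_def)
  with fO have "filterlim f (nhds 0) F" by (rule bigo_tendsto_0)
  then have "(\<lambda>h. g (f h) - poly p (f h)) \<in> O[F](\<lambda>h. f h ^ n)"
    using g unfolding expands_def by (rule landau_o.big.compose[rotated])
  also have "(\<lambda>h. f h ^ n) \<in> O[F](\<lambda>h. h ^ n)" using fO by (rule landau_o.big_power)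
  finally show ?thesis
    using expands_poly_compose[OF f(1), of p] unfolding expands_def by (rule bigo_diff_trans)
qed

lemma expands_unique:
  assumes "at_right 0 \<le> F" "expands F n f p" "expands F n f q"
  shows "agree n p q"
proof -
  have "(\<lambda>h. (f h - poly q h) - (f h - poly p h)) \<in> O[F](\<lambda>h. h ^ n)"
    using assms(2,3) unfolding expands_def by (rule sum_in_bigo(2)[rotated])
  then have "poly (p - q) \<in> O[at_right 0](\<lambda>h. h ^ n)"
    using landau_o.big.filter_mono[OF assms(1), of "poly (p - q)"]
    by (simp add: poly_diff[abs_def] fun_diff_def)
  from bigo_power_coeff_0[OF this] show ?thesis by (simp add: agree_def)
qed

end

text \<open>The filter \<open>nhds 0\<close> includes the point \<open>0\<close> itself, where the error term vanishes.\<close>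

lemma expands_at_0:
  assumes "expands (nhds 0) (Suc n) f p"
  shows "poly p 0 = f 0"
proof -
  obtain c where "\<forall>\<^sub>F h in nhds 0. norm (f h - poly p h) \<le> c * norm (h ^ Suc n)"
    using assms unfolding expands_def by (elim landau_o.bigE)
  then show ?thesis by (auto dest: eventually_nhds_x_imp_x)
qed

lemma expands_coeff_0:
  assumes "expands (at_right 0) (Suc n) f p" "(f \<longlongrightarrow> 0) (at_right 0)"
  shows "coeff p 0 = 0"
proof -
  have "((\<lambda>h::real. h ^ Suc n) \<longlongrightarrow> 0 ^ Suc n) (at_right 0)" by (intro tendsto_intros)
  then have "((\<lambda>h::real. h ^ Suc n) \<longlongrightarrow> 0) (at_right 0)" by (simp only: power_0_Suc)
  with assms(1)[unfolded expands_def] have "((\<lambda>h. f h - poly p h) \<longlongrightarrow> 0) (at_right 0)"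
    by (rule bigo_tendsto_0)
  from tendsto_diff[OF assms(2) this] have "(poly p \<longlongrightarrow> 0) (at_right 0)" by simp
  moreover have "(poly p \<longlongrightarrow> poly p 0) (at_right 0)" by (intro tendsto_intros)
  ultimately have "poly p 0 = 0" by (intro tendsto_unique[of "at_right (0::real)"]) auto
  then show ?thesis by (simp add: poly_0_coeff_0)
qed

lemma pcompose_power: "pcompose (p ^ n) q = pcompose p q ^ n" for p q :: "real poly"
  by (induction n) (simp_all add: pcompose_mult pcompose_1)

text \<open>Reversion of series, one coefficient at a time: the term of degree \<open>n\<close> of \<open>G\<close> contributes
  \<open>(coeff P 1) ^ n\<close> in degree \<open>n\<close> and nothing below.\<close>

lemma ex_compositional_inverse:
  assumes "coeff P 0 = 0" "coeff P 1 \<noteq> 0"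
  shows "\<exists>G. agree n (pcompose G P) [:0, 1:]"
proof (induction n)
  case (Suc n)
  then obtain G where G: "agree n (pcompose G P) [:0, 1:]" by blast
  define c where "c = coeff (pcompose G P - [:0, 1:]) n / coeff P 1 ^ n"
  obtain P' where P': "P = pCons 0 P'" using assms(1) by (cases P) auto
  have "P ^ n = monom 1 n * P' ^ n"
    by (simp add: P' monom_altdef power_mult_distrib[symmetric])
  then have co: "coeff (P ^ n) k = (if k < n then 0 else if k = n then coeff P 1 ^ n else coeff (P ^ n) k)" for k
    by (auto simp: coeff_monom_mult coeff_0_power P')
  have "pcompose (G - monom c n) P = pcompose G P - smult c (P ^ n)"
    by (simp add: pcompose_diff monom_altdef pcompose_smult pcompose_power pcompose_pCons)
  moreover have "coeff (smult c (P ^ n)) k = (if k = n then coeff (pcompose G P - [:0, 1:]) n else 0)" if "k < Suc n" for k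
    using that assms by (subst coeff_smult, subst co) (auto simp: c_def)
  ultimately have "agree (Suc n) (pcompose (G - monom c n) P) [:0, 1:]"
    using G by (auto simp: agree_def less_Suc_eq)
  then show ?case by blast
qed (simp add: agree_def)

text \<open>If \<open>f (y h)\<close> has an expansion, so does \<open>y\<close>. Since \<open>f\<close> is comparable to the identity near \<open>0\<close>,
  \<open>y = O(h)\<close>; so the error in \<open>poly G (f v) = v + O(v ^ m)\<close> is \<open>O(h ^ m)\<close> at \<open>v = y h\<close>. This serves both
  for the inverse of the coordinate change, where \<open>f (y h) = h\<close>, and for solving the quantile
  equation.\<close>

lemma expands_inverse:
  assumes F: "F \<le> nhds 0"
    and f: "expands (nhds 0) n f P" "coeff P 0 = 0" "coeff P 1 \<noteq> 0" "n \<ge> 2"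
    and y: "(y \<longlongrightarrow> 0) F"
    and s: "expands F m (\<lambda>h. f (y h)) s" "coeff s 0 = 0" "1 \<le> m" "m \<le> n"
    and G: "agree m (pcompose G P) [:0, 1:]"
  shows "expands F m y (pcompose G s)"
proof -
  have "(\<lambda>h. h) \<in> O[nhds 0](f)"
  proof -
    have "expands (nhds 0) 2 f [:0, coeff P 1:]"
      by (rule expands_agree[OF nhds_0_refl expands_mono[OF nhds_0_refl f(1,4)]])
         (use f(2) in \<open>auto simp: agree_def less_2_cases_iff\<close>)
    then obtain C where C: "\<forall>\<^sub>F h in nhds 0. \<bar>f h - coeff P 1 * h\<bar> \<le> C * h\<^sup>2" "C > 0"
      unfolding expands_def by (auto elim!: landau_o.bigE simp: mult.commute)
    define a where "a = \<bar>coeff P 1\<bar>"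
    have a: "a > 0" using f(3) by (simp add: a_def)
    have "\<forall>\<^sub>F h in nhds (0::real). \<bar>h\<bar> < a / (2 * C)"
      using a C(2) by (auto simp: eventually_nhds_metric dist_real_def intro!: exI[of _ "a / (2 * C)"])
    with C(1) have "\<forall>\<^sub>F h in nhds 0. norm h \<le> 2 / a * norm (f h)"
    proof eventually_elim
      case (elim h)
      have "C * h\<^sup>2 = (C * \<bar>h\<bar>) * \<bar>h\<bar>" by (simp add: power2_eq_square flip: abs_mult)
      also have "\<dots> \<le> (a / 2) * \<bar>h\<bar>"
        using elim(2) C(2) a by (intro mult_right_mono) (auto simp: field_simps)
      finally have "\<bar>f h - coeff P 1 * h\<bar> \<le> a / 2 * \<bar>h\<bar>" using elim(1) by linarith
      moreover have "\<bar>coeff P 1 * h\<bar> = a * \<bar>h\<bar>" by (simp add: a_def abs_mult)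
      ultimately have "a / 2 * \<bar>h\<bar> \<le> \<bar>f h\<bar>" by linarith
      then show ?case using a by (simp add: field_simps)
    qed
    then show ?thesis by (rule bigoI)
  qed
  from landau_o.big.compose[OF this y] have "y \<in> O[F](\<lambda>h. f (y h))" .
  also have "(\<lambda>h. f (y h)) \<in> O[F](\<lambda>h. h)" by (rule expands_bigo_id[OF F s(1-3)])
  finally have yO: "y \<in> O[F](\<lambda>h. h)" .
  have "expands (nhds 0) m (\<lambda>h. poly G (f h)) [:0, 1:]"
    by (rule expands_agree[OF nhds_0_refl expands_poly_compose[OF nhds_0_refl expands_mono[OF nhds_0_refl f(1) s(4)]] G])
  then have "(\<lambda>h. poly G (f (y h)) - y h) \<in> O[F](\<lambda>h. y h ^ m)"
    using landau_o.big.compose[OF _ y, of "\<lambda>h. poly G (f h) - poly [:0, 1:] h" "\<lambda>h. h ^ m"]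
    unfolding expands_def by simp
  also have "(\<lambda>h. y h ^ m) \<in> O[F](\<lambda>h. h ^ m)" using yO by (rule landau_o.big_power)
  finally have "(\<lambda>h. y h - poly G (f (y h))) \<in> O[F](\<lambda>h. h ^ m)"
    by (subst landau_o.big.uminus_in_iff[symmetric]) (simp only: minus_diff_eq)
  then show ?thesis
    using expands_poly_compose[OF F s(1), of G] unfolding expands_def by (rule bigo_diff_trans)
qed

lemma ex_poly_antiderivative: "\<exists>p :: real poly. pderiv p = q \<and> coeff p 0 = c"
proof -
  define p where "p = [:c:] + (\<Sum>k\<le>degree q. monom (coeff q k / (real k + 1)) (Suc k))"
  have "coeff p (Suc k) = coeff q k / (real k + 1)" for k
    by (simp add: p_def coeff_sum coeff_eq_0)
  then have "pderiv p = q"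
    by (intro poly_eqI) (simp add: coeff_pderiv add.commute)
  then show ?thesis
    by (intro exI[of _ p]) (simp add: p_def coeff_sum)
qed

text \<open>Mean value theorem: integrating an error \<open>O(h ^ n)\<close> gains one power of \<open>h\<close>.\<close>

lemma expands_antiderivative:
  assumes d: "\<forall>\<^sub>F h in nhds 0. (f has_real_derivative f' h) (at h)"
    and f': "expands (nhds 0) n f' (pderiv p)" and p0: "coeff p 0 = f 0"
  shows "expands (nhds 0) (Suc n) f p"
proof -
  obtain C where C: "\<forall>\<^sub>F h in nhds 0. \<bar>f' h - poly (pderiv p) h\<bar> \<le> C * \<bar>h\<bar> ^ n"
    using f' unfolding expands_def by (auto elim!: landau_o.bigE simp: power_abs)
  from eventually_conj[OF d C] obtain r where r: "r > 0"
    and dr: "\<And>h. \<bar>h\<bar> < r \<Longrightarrow> (f has_real_derivative f' h) (at h)"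
    and Cr: "\<And>h. \<bar>h\<bar> < r \<Longrightarrow> \<bar>f' h - poly (pderiv p) h\<bar> \<le> C * \<bar>h\<bar> ^ n"
    by (auto simp: eventually_nhds_metric dist_real_def)
  have C0: "C \<ge> 0"
  proof -
    have "0 \<le> C * \<bar>r/2\<bar> ^ n" using Cr[of "r/2"] r by (smt (verit) abs_ge_zero field_sum_of_halves)
    moreover have "\<bar>r/2\<bar> ^ n > 0" using r by simp
    ultimately show ?thesis by (simp only: zero_le_mult_iff) linarith
  qed
  have "\<bar>f h - poly p h\<bar> \<le> C * \<bar>h\<bar> ^ Suc n" if h: "\<bar>h\<bar> < r" for h
  proof -
    have "norm ((f h - poly p h) - (f 0 - poly p 0)) \<le> (C * \<bar>h\<bar> ^ n) * norm (h - 0)"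
    proof (rule field_differentiable_bound[where S = "cball 0 \<bar>h\<bar>"])
      show "((\<lambda>h. f h - poly p h) has_real_derivative f' z - poly (pderiv p) z) (at z within cball 0 \<bar>h\<bar>)"
        if "z \<in> cball 0 \<bar>h\<bar>" for z
        using that h by (intro derivative_intros DERIV_subset[OF dr] DERIV_subset[OF poly_DERIV]) auto
      show "norm (f' z - poly (pderiv p) z) \<le> C * \<bar>h\<bar> ^ n" if "z \<in> cball 0 \<bar>h\<bar>" for z
      proof -
        have "\<bar>z\<bar> \<le> \<bar>h\<bar>" using that by simp
        then have "C * \<bar>z\<bar> ^ n \<le> C * \<bar>h\<bar> ^ n" using C0 by (intro mult_left_mono power_mono) auto
        then show ?thesis using Cr[of z] \<open>\<bar>z\<bar> \<le> \<bar>h\<bar>\<close> h by simp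
      qed
    qed auto
    then show ?thesis using p0 by (simp add: poly_0_coeff_0 mult_ac)
  qed
  then have "\<forall>\<^sub>F h in nhds 0. norm (f h - poly p h) \<le> C * norm (h ^ Suc n)"
    using r by (auto simp: eventually_nhds_metric dist_real_def power_abs abs_mult)
  then show ?thesis unfolding expands_def by (rule bigoI)
qed

text \<open>The tail of the series is \<open>h ^ n\<close> times a series that is bounded near \<open>0\<close>.\<close>

lemma expands_power_series:
  assumes r: "r > 0" and s: "\<And>h. \<bar>h\<bar> < r \<Longrightarrow> (\<lambda>k. c k * h ^ k) sums f h"
  shows "expands (nhds 0) n f (\<Sum>k<n. monom (c k) k)"
proof -
  define M where "M = (\<Sum>k. \<bar>c (k + n)\<bar> * (r / 2) ^ k)"
  have "summable (\<lambda>k. c k * ((r / 2) * (3/2)) ^ k)"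
    using s[of "(r/2) * (3/2)"] r by (simp add: sums_iff)
  from powser_insidea[OF this, of "r / 2"] have "summable (\<lambda>k. \<bar>c k * (r / 2) ^ k\<bar>)"
    using r by simp
  then have "summable (\<lambda>k. \<bar>c (k + n) * (r / 2) ^ (k + n)\<bar>)" by (subst summable_iff_shift)
  then have "summable (\<lambda>k. \<bar>c (k + n) * (r / 2) ^ (k + n)\<bar> * (1 / (r / 2) ^ n))"
    by (rule summable_mult2)
  then have sM: "summable (\<lambda>k. \<bar>c (k + n)\<bar> * (r / 2) ^ k)"
    using r by (simp add: abs_mult power_add)
  have "\<bar>f h - (\<Sum>k<n. c k * h ^ k)\<bar> \<le> M * \<bar>h ^ n\<bar>" if h: "\<bar>h\<bar> < r / 2" for h
  proof -
    have sm: "norm (c (k + n) * h ^ k) \<le> \<bar>c (k + n)\<bar> * (r / 2) ^ k" for k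
      using h by (auto simp: abs_mult power_abs intro!: mult_left_mono power_mono)
    have "(\<lambda>k. c (k + n) * h ^ (k + n)) sums (f h - (\<Sum>k<n. c k * h ^ k))"
      using s[of h] h r by (subst sums_iff_shift) simp
    moreover have "(\<lambda>k. h ^ n * (c (k + n) * h ^ k)) sums (h ^ n * (\<Sum>k. c (k + n) * h ^ k))"
      by (intro sums_mult summable_sums summable_comparison_test'[OF sM sm])
    ultimately have "f h - (\<Sum>k<n. c k * h ^ k) = h ^ n * (\<Sum>k. c (k + n) * h ^ k)"
      by (intro sums_unique2[of "\<lambda>k. c (k + n) * h ^ (k + n)"]) (simp_all add: power_add mult_ac)
    moreover
    have "\<bar>\<Sum>k. c (k + n) * h ^ k\<bar> \<le> M"
      unfolding M_def using norm_suminf_le[OF sm sM] by simp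
    then have "\<bar>h ^ n\<bar> * \<bar>\<Sum>k. c (k + n) * h ^ k\<bar> \<le> \<bar>h ^ n\<bar> * M"
      by (rule mult_left_mono) simp
    ultimately show ?thesis by (simp only: abs_mult mult.commute)
  qed
  then have "\<forall>\<^sub>F h in nhds 0. norm (f h - (\<Sum>k<n. c k * h ^ k)) \<le> M * norm (h ^ n)"
    using r by (auto simp: eventually_nhds_metric dist_real_def intro!: exI[of _ "r / 2"])
  then show ?thesis unfolding expands_def by (intro bigoI) (simp add: poly_sum poly_monom)
qed

section \<open>The coordinate in which the gamma density is almost Gaussian\<close>

text \<open>The value at \<open>0\<close> is the limit there; \<open>eta\<close> is thus the smooth choice of sign of the square
  root of \<open>2 (w - ln (1 + w))\<close>.\<close>

definition defect :: "real \<Rightarrow> real" where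
  "defect w = (if w = 0 then 1 else 2 * (w - ln (1 + w)) / w\<^sup>2)"

definition eta :: "real \<Rightarrow> real" where
  "eta w = w * sqrt (defect w)"

lemma defect_pos:
  assumes "w > -1"
  shows "defect w > 0"
proof (cases "w = 0")
  case False
  have "ln (1 + w) \<le> w" using ln_le_minus_one[of "1 + w"] assms by simp
  moreover have "ln (1 + w) \<noteq> w" using ln_eq_minus_one[of "1 + w"] assms False by auto
  ultimately show ?thesis using False by (simp add: defect_def)
qed (simp add: defect_def)

lemma eta_0 [simp]: "eta 0 = 0"
  by (simp add: eta_def)

lemma eta_squared:
  assumes "w > -1"
  shows "(eta w)\<^sup>2 = 2 * (w - ln (1 + w))"
proof -
  have "(eta w)\<^sup>2 = w\<^sup>2 * defect w"
    using defect_pos[OF assms] by (simp add: eta_def power_mult_distrib)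
  then show ?thesis by (simp add: defect_def)
qed

lemma eta_pos_iff: "w > -1 \<Longrightarrow> eta w > 0 \<longleftrightarrow> w > 0"
  using defect_pos[of w] by (simp add: eta_def zero_less_mult_iff)

lemma eta_neg_iff: "w > -1 \<Longrightarrow> eta w < 0 \<longleftrightarrow> w < 0"
  using defect_pos[of w] by (simp add: eta_def mult_less_0_iff)

lemma eta_has_derivative:
  assumes "w > -1" "w \<noteq> 0"
  shows "(eta has_real_derivative w / ((1 + w) * eta w)) (at w)"
proof -
  define S where "S = (if w > 0 then {0<..} else {-1<..<0::real})"
  define s where "s = (if w > 0 then 1 else - 1 :: real)"
  have S: "open S" "w \<in> S" using assms by (auto simp: S_def)
  have eq: "eta v = s * sqrt (2 * (v - ln (1 + v)))" if "v \<in> S" for v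
  proof -
    have v: "v > -1" using that by (auto simp: S_def split: if_splits)
    have "sqrt (2 * (v - ln (1 + v))) = \<bar>eta v\<bar>" using eta_squared[OF v] by (metis real_sqrt_abs)
    then show ?thesis using eta_pos_iff[OF v] eta_neg_iff[OF v] that by (auto simp: S_def s_def split: if_splits)
  qed
  have p: "2 * (w - ln (1 + w)) > 0"
    using eta_squared[OF assms(1)] eta_pos_iff[OF assms(1)] eta_neg_iff[OF assms(1)] assms(2)
    by (metis linorder_neqE_linordered_idom order_less_irrefl zero_less_power2)
  have "((\<lambda>v. s * sqrt (2 * (v - ln (1 + v)))) has_real_derivative
          s * ((2 * (1 - 1 / (1 + w))) * (inverse (sqrt (2 * (w - ln (1 + w)))) / 2))) (at w)"
    using p assms by (auto intro!: derivative_eq_intros)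
  also have "s * ((2 * (1 - 1 / (1 + w))) * (inverse (sqrt (2 * (w - ln (1 + w)))) / 2)) = w / ((1 + w) * eta w)"
    using p assms unfolding eq[OF S(2)] by (auto simp: s_def divide_simps)
  finally show ?thesis
    by (rule has_field_derivative_transform_within_open[OF _ S]) (simp add: eq)
qed

lemma eta_strict_mono:
  assumes "-1 < a" "a < b"
  shows "eta a < eta b"
proof -
  have d: "((\<lambda>v. v - ln (1 + v)) has_real_derivative v / (1 + v)) (at v)" if "v > -1" for v
    using that by (auto intro!: derivative_eq_intros simp: field_simps)
  have c: "continuous_on {u..v} (\<lambda>v. v - ln (1 + v))" if "u > -1" for u v :: real
    using that by (intro continuous_intros) auto
  consider "0 \<le> a" | "b \<le> 0" | "a < 0" "b > 0" by linarith
  then show ?thesis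
  proof cases
    case 1
    have "a - ln (1 + a) < b - ln (1 + b)"
    proof (rule DERIV_pos_imp_increasing_open[OF assms(2) _ c[OF assms(1)]])
      fix x assume "a < x" "x < b"
      then show "\<exists>y. ((\<lambda>v. v - ln (1 + v)) has_real_derivative y) (at x) \<and> 0 < y"
        using 1 by (intro exI[of _ "x / (1 + x)"] conjI d) auto
    qed
    then have "(eta a)\<^sup>2 < (eta b)\<^sup>2" using eta_squared[of a] eta_squared[of b] assms by simp
    moreover have "eta b \<ge> 0" using eta_pos_iff[of b] 1 assms by simp
    ultimately show ?thesis by (rule power2_less_imp_less)
  next
    case 2
    have "a - ln (1 + a) > b - ln (1 + b)"
    proof (rule DERIV_neg_imp_decreasing_open[OF assms(2) _ c[OF assms(1)]])
      fix x assume "a < x" "x < b"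
      then show "\<exists>y. ((\<lambda>v. v - ln (1 + v)) has_real_derivative y) (at x) \<and> y < 0"
        using 2 assms by (intro exI[of _ "x / (1 + x)"] conjI d) (auto simp: divide_less_0_iff)
    qed
    then have "(- eta b)\<^sup>2 < (- eta a)\<^sup>2" using eta_squared[of a] eta_squared[of b] assms by simp
    moreover have "- eta a \<ge> 0" using eta_neg_iff[of a] 2 assms by simp
    ultimately show ?thesis using power2_less_imp_less by fastforce
  next
    case 3
    then show ?thesis using eta_neg_iff[of a] eta_pos_iff[of b] assms by simp
  qed
qed

text \<open>On each half-line the intermediate value theorem is applied between \<open>0\<close> and an explicit point
  at which the square of \<open>eta\<close> is at least \<open>y\<^sup>2\<close>.\<close>

lemma eta_surj: "\<exists>w>-1. eta w = y"
proof -
  have c: "continuous_on {u..v} (\<lambda>v. 2 * (v - ln (1 + v)))" if "u > -1" for u v :: real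
    using that by (intro continuous_intros) auto
  consider "y = 0" | "y > 0" | "y < 0" by linarith
  then show ?thesis
  proof cases
    case 1
    then show ?thesis by (intro exI[of _ 0]) auto
  next
    case 2
    \<comment> \<open>At \<open>w = exp y - 1\<close> the squared coordinate is \<open>2 (exp y - 1 - y)\<close>.\<close>
    have "1 + y + y\<^sup>2 / 2 \<le> exp y" using 2 by (intro exp_lower_Taylor_quadratic) simp
    then obtain w where w: "0 \<le> w" "2 * (w - ln (1 + w)) = y\<^sup>2"
      using IVT'[of "\<lambda>v. 2 * (v - ln (1 + v))" 0 "y\<^sup>2" "exp y - 1", OF _ _ _ c] 2 by auto
    then have "(eta w)\<^sup>2 = y\<^sup>2" using eta_squared[of w] by simp
    moreover have "eta w \<ge> 0" using eta_neg_iff[of w] w(1) by simp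
    ultimately show ?thesis using w(1) 2 by (intro exI[of _ w]) (simp add: power2_eq_iff_nonneg)
  next
    case 3
    \<comment> \<open>Chosen so that \<open>2 * (a - ln (1 + a)) = y\<^sup>2 + 2 * (1 + a)\<close>.\<close>
    define a where "a = exp (- y\<^sup>2 / 2 - 1) - 1"
    have "exp (- y\<^sup>2 / 2 - 1) \<le> 1"
      by (subst exp_le_one_iff) (use zero_le_power2[of y] in linarith)
    then have a: "a > -1" "a \<le> 0" by (simp_all only: a_def exp_gt_zero less_diff_eq) simp_all
    have la: "ln (1 + a) = - y\<^sup>2 / 2 - 1" by (simp add: a_def)
    have "y\<^sup>2 \<le> 2 * (a - ln (1 + a))" using a(1) zero_le_power2[of y] unfolding la by argo
    then obtain w where w: "a \<le> w" "w \<le> 0" "2 * (w - ln (1 + w)) = y\<^sup>2"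
      using IVT2'[of "\<lambda>v. 2 * (v - ln (1 + v))" 0 "y\<^sup>2" a, OF _ _ _ c] a by auto
    then have "(eta w)\<^sup>2 = y\<^sup>2" using eta_squared[of w] a by simp
    then have "eta w = y \<or> eta w = - y" by (simp add: power2_eq_iff)
    moreover have "eta w \<le> 0" using eta_pos_iff[of w] w a(1) by simp
    ultimately show ?thesis using w(1) a(1) 3 by (intro exI[of _ w]) auto
  qed
qed

definition eta_inv :: "real \<Rightarrow> real" where
  "eta_inv y = (SOME w. w > -1 \<and> eta w = y)"

lemma eta_inv: "eta_inv y > -1" "eta (eta_inv y) = y"
  using someI_ex[of "\<lambda>w. w > -1 \<and> eta w = y"] eta_surj[of y] unfolding eta_inv_def by blast+

lemma eta_inj: "a > -1 \<Longrightarrow> b > -1 \<Longrightarrow> eta a = eta b \<Longrightarrow> a = b"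
  using eta_strict_mono[of a b] eta_strict_mono[of b a] by (cases a b rule: linorder_cases) auto

lemma eta_inv_eta [simp]: "w > -1 \<Longrightarrow> eta_inv (eta w) = w"
  by (rule eta_inj) (simp_all add: eta_inv)

lemma eta_inv_0 [simp]: "eta_inv 0 = 0"
  using eta_inv_eta[of 0] by simp

lemma eta_less_iff: "a > -1 \<Longrightarrow> b > -1 \<Longrightarrow> eta a < eta b \<longleftrightarrow> a < b"
  using eta_strict_mono[of a b] eta_strict_mono[of b a] by (cases a b rule: linorder_cases) auto

lemma eta_inv_less_iff: "eta_inv a < eta_inv b \<longleftrightarrow> a < b"
  using eta_less_iff[OF eta_inv(1) eta_inv(1), of a b] by (simp add: eta_inv)

lemma eta_inv_tendsto_0: "(eta_inv \<longlongrightarrow> 0) (nhds 0)"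
proof (rule order_tendstoI)
  fix a :: real assume "a < 0"
  define b where "b = max a (-1/2)"
  have b: "b > -1" "b < 0" "b \<ge> a" using \<open>a < 0\<close> by (auto simp: b_def)
  have "\<forall>\<^sub>F y in nhds 0. y \<in> {eta b<..}"
    using eta_neg_iff[of b] b by (intro eventually_nhds_in_open) auto
  then show "\<forall>\<^sub>F y in nhds 0. a < eta_inv y"
  proof eventually_elim
    case (elim y)
    then have "b < eta_inv y" using eta_inv_less_iff[of "eta b" y] b by simp
    then show ?case using b by simp
  qed
next
  fix a :: real assume a: "a > 0"
  have "\<forall>\<^sub>F y in nhds 0. y \<in> {..<eta a}"
    using eta_pos_iff[of a] a by (intro eventually_nhds_in_open) auto
  then show "\<forall>\<^sub>F y in nhds 0. eta_inv y < a"
  proof eventually_elim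
    case (elim y)
    then show ?case using eta_inv_less_iff[of y "eta a"] a by simp
  qed
qed

text \<open>The quotient \<open>y / eta_inv y\<close>, continued by \<open>1\<close> to \<open>y = 0\<close>.\<close>

definition weight :: "real \<Rightarrow> real" where
  "weight y = sqrt (defect (eta_inv y))"

lemma weight_eta: "w > -1 \<Longrightarrow> w * weight (eta w) = eta w"
  by (simp add: weight_def) (simp add: eta_def)

lemma eta_inv_weight: "eta_inv y * weight y = y"
  using weight_eta[OF eta_inv(1), of y] by (simp add: eta_inv)

lemma weight_pos: "weight y > 0"
  using defect_pos[OF eta_inv(1)] by (simp add: weight_def)

lemma expands_defect: "expands (nhds 0) n defect (\<Sum>k<n. monom (2 * (-1) ^ k / (real k + 2)) k)"
proof (rule expands_power_series[of 1])
  fix w :: real assume w: "\<bar>w\<bar> < 1"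
  show "(\<lambda>k. 2 * (-1) ^ k / (real k + 2) * w ^ k) sums defect w"
  proof (cases "w = 0")
    case True
    have "(\<lambda>k. 2 * (-1) ^ k / (real k + 2) * 0 ^ k) sums (2 * (-1) ^ 0 / (real 0 + 2) :: real)"
      by (rule powser_sums_zero)
    then show ?thesis using True by (simp add: defect_def)
  next
    case False
    have "(\<lambda>k. - ((- w) ^ (k + 2)) / real (k + 2)) sums (ln (1 + w) - (\<Sum>k<2. - ((- w) ^ k) / real k))"
      by (rule sums_split_initial_segment[OF ln_series'[OF w]])
    then have "(\<lambda>k. (- ((- w) ^ (k + 2)) / real (k + 2)) * (- 2 / w\<^sup>2)) sums ((ln (1 + w) - w) * (- 2 / w\<^sup>2))"
      by (intro sums_mult2) (simp add: numeral_2_eq_2)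
    moreover have "(- ((- w) ^ (k + 2)) / real (k + 2)) * (- 2 / w\<^sup>2) = 2 * (-1) ^ k / (real k + 2) * w ^ k" for k
      using False by (simp add: power_minus[of w] power_add power2_eq_square add.commute)
    moreover have "(ln (1 + w) - w) * (- 2 / w\<^sup>2) = defect w"
      using False by (simp add: defect_def field_simps)
    ultimately show ?thesis by simp
  qed
qed simp

lemma expands_sqrt: "expands (nhds 0) n (\<lambda>h. sqrt (1 + h)) (\<Sum>k<n. monom ((1/2) gchoose k) k)"
  by (rule expands_power_series[of 1]) (auto intro: sqrt_series)

lemma ex_expands_sqrt_defect: "\<exists>p. coeff p 0 = 1 \<and> expands (nhds 0) n (\<lambda>w. sqrt (defect w)) p"
proof -
  define q where "q = (\<Sum>k<Suc n. monom (2 * (-1) ^ k / (real k + 2)) k) - [:1:]"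
  have "expands (nhds 0) (Suc n) (\<lambda>w. defect w - 1) q"
    unfolding q_def by (intro expands_diff expands_defect expands_const nhds_0_refl)
  moreover have "coeff q 0 = 0" by (simp add: q_def coeff_sum)
  ultimately have "expands (nhds 0) (Suc n) (\<lambda>w. sqrt (1 + (defect w - 1)))
     (pcompose (\<Sum>k<Suc n. monom ((1/2) gchoose k) k) q)"
    by (intro expands_compose[OF nhds_0_refl expands_sqrt]) auto
  moreover have "coeff (pcompose (\<Sum>k<Suc n. monom ((1/2) gchoose k) k) q) 0 = 1"
    using \<open>coeff q 0 = 0\<close> by (simp add: pcompose_coeff_0 poly_0_coeff_0 coeff_sum)
  ultimately have "coeff r 0 = 1 \<and> expands (nhds 0) n (\<lambda>w. sqrt (defect w)) r"
    if "r = pcompose (\<Sum>k<Suc n. monom ((1/2) gchoose k) k) q" for r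
    using expands_mono[OF nhds_0_refl, of "Suc n" _ r n] unfolding that[symmetric] by simp
  then show ?thesis by blast
qed

text \<open>Substitution of \<open>2 (w - ln (1 + w)) / w\<^sup>2 = 1 - 2w/3 + w\<^sup>2/2 + O(w\<^sup>3)\<close> into
  \<open>sqrt (1 + h) = 1 + h/2 - h\<^sup>2/8 + O(h\<^sup>3)\<close>.\<close>

lemma expands_sqrt_defect_3: "expands (nhds 0) 3 (\<lambda>w. sqrt (defect w)) [:1, -1/3, 7/36:]"
proof -
  have d: "expands (nhds 0) 3 defect [:1, -2/3, 1/2:]"
    by (rule expands_agree[OF nhds_0_refl expands_defect])
       (simp add: agree_def numeral_3_eq_3 less_Suc_eq coeff_sum)
  have s: "expands (nhds 0) 3 (\<lambda>h. sqrt (1 + h)) [:1, 1/2, -1/8:]"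
    by (rule expands_agree[OF nhds_0_refl expands_sqrt])
       (simp add: agree_def numeral_3_eq_3 less_Suc_eq coeff_sum gbinomial_prod_rev fact_numeral)
  have "expands (nhds 0) 3 (\<lambda>w. sqrt (1 + (defect w - 1))) (pcompose [:1, 1/2, -1/8:] ([:1, -2/3, 1/2:] - [:1:]))"
    by (rule expands_compose[OF nhds_0_refl s expands_diff[OF nhds_0_refl d expands_const[OF nhds_0_refl]]]) auto
  from expands_agree[OF nhds_0_refl this, of "[:1, -1/3, 7/36:]"] show ?thesis
    by (simp add: agree_def numeral_3_eq_3 less_Suc_eq pcompose_pCons)
qed

lemma expands_eta:
  assumes "expands (nhds 0) n (\<lambda>w. sqrt (defect w)) p"
  shows "expands (nhds 0) (Suc n) eta (pCons 0 p)"
  using expands_shift[OF nhds_0_refl assms, of 1] by (simp add: eta_def[abs_def] monom_altdef)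

lemma expands_eta_inv:
  assumes p: "expands (nhds 0) n (\<lambda>w. sqrt (defect w)) p" "coeff p 0 = 1"
    and G: "agree (Suc n) (pcompose G (pCons 0 p)) [:0, 1:]" and n: "n \<ge> 1"
  shows "expands (nhds 0) (Suc n) eta_inv G"
proof -
  have "expands (nhds 0) (Suc n) eta_inv (pcompose G [:0, 1:])"
    by (rule expands_inverse[OF nhds_0_refl expands_eta[OF p(1)] _ _ _ eta_inv_tendsto_0 _ _ _ _ G])
       (use p(2) n in \<open>auto simp: eta_inv expands_id\<close>)
  then show ?thesis by simp
qed

lemma ex_expands_eta_inv: "\<exists>q. coeff q 0 = 0 \<and> expands (nhds 0) n eta_inv q"
proof -
  obtain p where p: "coeff p 0 = 1" "expands (nhds 0) (Suc n) (\<lambda>w. sqrt (defect w)) p"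
    using ex_expands_sqrt_defect by blast
  obtain G where G: "agree (Suc (Suc n)) (pcompose G (pCons 0 p)) [:0, 1:]"
    using ex_compositional_inverse[of "pCons 0 p"] p(1) by auto
  have "expands (nhds 0) (Suc (Suc n)) eta_inv G" by (rule expands_eta_inv[OF p(2,1) G]) simp
  moreover have "coeff G 0 = 0"
    using G[unfolded agree_def, rule_format, of 0] by (simp add: pcompose_coeff_0 poly_0_coeff_0)
  ultimately show ?thesis using expands_mono[OF nhds_0_refl, of "Suc (Suc n)" _ _ n] by auto
qed

lemma expands_eta_inv_4: "expands (nhds 0) 4 eta_inv [:0, 1, 1/3, 1/36:]"
  using expands_eta_inv[OF expands_sqrt_defect_3, of "[:0, 1, 1/3, 1/36:]"]
  by (simp add: agree_def numeral_eq_Suc less_Suc_eq pcompose_pCons)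

lemma ex_expands_weight: "\<exists>p. expands (nhds 0) n weight p"
proof -
  obtain p where p: "expands (nhds 0) (Suc n) (\<lambda>w. sqrt (defect w)) p"
    using ex_expands_sqrt_defect by blast
  obtain q where q: "coeff q 0 = 0" "expands (nhds 0) (Suc n) eta_inv q"
    using ex_expands_eta_inv by blast
  have "expands (nhds 0) (Suc n) weight (pcompose p q)"
    unfolding weight_def[abs_def] by (rule expands_compose[OF nhds_0_refl p q(2,1)]) simp
  then show ?thesis using expands_mono[OF nhds_0_refl, of "Suc n" _ _ n] by auto
qed

lemma expands_weight_3: "expands (nhds 0) 3 weight [:1, -1/3, 1/12:]"
proof -
  have "expands (nhds 0) 3 weight (pcompose [:1, -1/3, 7/36:] [:0, 1, 1/3, 1/36:])"
    unfolding weight_def[abs_def]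
    by (rule expands_compose[OF nhds_0_refl expands_sqrt_defect_3 expands_mono[OF nhds_0_refl expands_eta_inv_4]]) auto
  from expands_agree[OF nhds_0_refl this, of "[:1, -1/3, 1/12:]"] show ?thesis
    by (simp add: agree_def numeral_3_eq_3 less_Suc_eq pcompose_pCons)
qed

text \<open>Away from \<open>0\<close> the inverse \<open>eta_inv\<close> is bounded away from \<open>0\<close> by monotonicity, and
  \<open>weight y = y / eta_inv y\<close>.\<close>

lemma weight_le_away_from_0:
  assumes "\<delta> > 0"
  obtains c where "c > 0" "\<And>y. \<bar>y\<bar> \<ge> \<delta> \<Longrightarrow> weight y \<le> c * \<bar>y\<bar>"
proof -
  define c where "c = min (eta_inv \<delta>) (- eta_inv (- \<delta>))"
  have c: "c > 0" using eta_inv_less_iff[of 0 \<delta>] eta_inv_less_iff[of "-\<delta>" 0] assms by (simp add: c_def)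
  show ?thesis
  proof
    show "1 / c > 0" using c by simp
    fix y assume y: "\<bar>y\<bar> \<ge> \<delta>"
    have "\<bar>eta_inv y\<bar> \<ge> c"
      using eta_inv_less_iff[of y \<delta>] eta_inv_less_iff[of "-\<delta>" y] y unfolding c_def by linarith
    then have "c * weight y \<le> \<bar>eta_inv y\<bar> * weight y" using weight_pos[of y] by (intro mult_right_mono) auto
    also have "\<dots> = \<bar>y\<bar>" using eta_inv_weight[of y] weight_pos[of y] by (metis abs_mult abs_of_pos)
    finally show "weight y \<le> 1 / c * \<bar>y\<bar>" using c by (simp add: field_simps)
  qed
qed

text \<open>Near \<open>0\<close> this is the expansion; elsewhere \<open>weight\<close> grows at most linearly and the polynomial has
  degree at most \<open>n\<close>. The bound holds on the whole line, so it can be integrated against the Gaussian.\<close>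

lemma weight_global_bound:
  assumes p: "expands (nhds 0) n weight p" and n: "n \<ge> 1" and deg: "degree p \<le> n"
  obtains C where "\<And>y. \<bar>weight y - poly p y\<bar> \<le> C * \<bar>y\<bar> ^ n"
proof -
  obtain C where "C > 0" "\<forall>\<^sub>F y in nhds 0. \<bar>weight y - poly p y\<bar> \<le> C * \<bar>y\<bar> ^ n"
    using p unfolding expands_def by (auto elim!: landau_o.bigE simp: power_abs)
  then obtain \<delta> where C: "C > 0" and \<delta>: "\<delta> > 0" "\<And>y. \<bar>y\<bar> < \<delta> \<Longrightarrow> \<bar>weight y - poly p y\<bar> \<le> C * \<bar>y\<bar> ^ n"
    by (auto simp: eventually_nhds_metric dist_real_def)
  obtain c where c: "c > 0" "\<And>y. \<bar>y\<bar> \<ge> \<delta> \<Longrightarrow> weight y \<le> c * \<bar>y\<bar>"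
    using weight_le_away_from_0[OF \<delta>(1)] by blast
  have pow: "\<bar>y\<bar> ^ k \<le> (1 / \<delta>) ^ (n - k) * \<bar>y\<bar> ^ n" if "\<bar>y\<bar> \<ge> \<delta>" "k \<le> n" for y k
  proof -
    have "1 \<le> (1 / \<delta> * \<bar>y\<bar>) ^ (n - k)" using that \<delta>(1) by (intro one_le_power) (simp add: field_simps)
    then have "\<bar>y\<bar> ^ k * 1 \<le> \<bar>y\<bar> ^ k * (1 / \<delta> * \<bar>y\<bar>) ^ (n - k)" by (intro mult_left_mono) auto
    also have "\<dots> = (1 / \<delta>) ^ (n - k) * (\<bar>y\<bar> ^ k * \<bar>y\<bar> ^ (n - k))" by (simp only: power_mult_distrib mult_ac)
    also have "\<bar>y\<bar> ^ k * \<bar>y\<bar> ^ (n - k) = \<bar>y\<bar> ^ n" using that by (simp flip: power_add)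
    finally show ?thesis by simp
  qed
  define K where "K = C + c * (1 / \<delta>) ^ (n - 1) + (\<Sum>k\<le>degree p. \<bar>coeff p k\<bar> * (1 / \<delta>) ^ (n - k))"
  have sn: "0 \<le> (\<Sum>k\<le>degree p. \<bar>coeff p k\<bar> * (1 / \<delta>) ^ (n - k))" using \<delta> by (intro sum_nonneg) auto
  have cn: "0 \<le> c * (1 / \<delta>) ^ (n - 1)" using c \<delta> by simp
  show ?thesis
  proof
    fix y
    show "\<bar>weight y - poly p y\<bar> \<le> K * \<bar>y\<bar> ^ n"
    proof (cases "\<bar>y\<bar> < \<delta>")
      case True
      have "C * \<bar>y\<bar> ^ n \<le> K * \<bar>y\<bar> ^ n" using sn cn unfolding K_def by (intro mult_right_mono) auto
      then show ?thesis using \<delta>(2)[OF True] by linarith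
    next
      case False
      then have y: "\<bar>y\<bar> \<ge> \<delta>" by simp
      have "\<bar>weight y\<bar> \<le> c * \<bar>y\<bar> ^ 1" using c(2)[OF y] weight_pos[of y] by simp
      also have "\<dots> \<le> c * ((1 / \<delta>) ^ (n - 1) * \<bar>y\<bar> ^ n)" using c(1) pow[OF y n] by (intro mult_left_mono) auto
      finally have 1: "\<bar>weight y\<bar> \<le> (c * (1 / \<delta>) ^ (n - 1)) * \<bar>y\<bar> ^ n" by simp
      have "\<bar>poly p y\<bar> \<le> (\<Sum>k\<le>degree p. \<bar>coeff p k * y ^ k\<bar>)" unfolding poly_altdef by (rule sum_abs)
      also have "\<dots> \<le> (\<Sum>k\<le>degree p. \<bar>coeff p k\<bar> * (1 / \<delta>) ^ (n - k) * \<bar>y\<bar> ^ n)"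
      proof (rule sum_mono)
        fix k assume "k \<in> {..degree p}"
        then have "k \<le> n" using deg by simp
        have "\<bar>coeff p k\<bar> * \<bar>y\<bar> ^ k \<le> \<bar>coeff p k\<bar> * ((1 / \<delta>) ^ (n - k) * \<bar>y\<bar> ^ n)"
          by (rule mult_left_mono[OF pow[OF y \<open>k \<le> n\<close>]]) simp
        then show "\<bar>coeff p k * y ^ k\<bar> \<le> \<bar>coeff p k\<bar> * (1 / \<delta>) ^ (n - k) * \<bar>y\<bar> ^ n"
          by (simp add: abs_mult power_abs)
      qed
      finally have 2: "\<bar>poly p y\<bar> \<le> (\<Sum>k\<le>degree p. \<bar>coeff p k\<bar> * (1 / \<delta>) ^ (n - k)) * \<bar>y\<bar> ^ n"
        by (simp add: sum_distrib_right)
      have "0 \<le> C * \<bar>y\<bar> ^ n" using C by simp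
      moreover have "\<bar>weight y - poly p y\<bar> \<le> \<bar>weight y\<bar> + \<bar>poly p y\<bar>" by (rule abs_triangle_ineq4)
      ultimately show ?thesis using 1 2 unfolding K_def ring_distribs by linarith
    qed
  qed
qed

section \<open>Partial moments of the Gaussian\<close>

definition gauss_moment :: "nat \<Rightarrow> real set \<Rightarrow> real" where
  "gauss_moment k A = integral A (\<lambda>s. s ^ k * exp (- s\<^sup>2 / 2))"

lemma gauss_power_abs_integrable:
  fixes A :: "real set"
  assumes "A \<in> sets lebesgue"
  shows "(\<lambda>s. s ^ k * exp (- s\<^sup>2 / 2)) absolutely_integrable_on A"
    and "(\<lambda>s. \<bar>s\<bar> ^ k * exp (- s\<^sup>2 / 2)) absolutely_integrable_on A"
proof -
  have "integrable lborel (\<lambda>s. sqrt (2 * pi) * (std_normal_density s * s ^ k))"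
    by (intro integrable_mult_right integrable_std_normal_moment)
  then have "integrable lborel (\<lambda>s. s ^ k * exp (- s\<^sup>2 / 2) :: real)"
    by (simp add: std_normal_density_def mult.commute)
  then have 1: "(\<lambda>s. s ^ k * exp (- s\<^sup>2 / 2)) absolutely_integrable_on (UNIV :: real set)"
    by (simp add: set_integrable_def integrable_completion borel_measurable_integrable)
  then show "(\<lambda>s. s ^ k * exp (- s\<^sup>2 / 2)) absolutely_integrable_on A"
    by (rule set_integrable_subset) (use assms in auto)
  have "(\<lambda>s. norm (s ^ k * exp (- s\<^sup>2 / 2))) absolutely_integrable_on (UNIV :: real set)"
    using 1 by (rule absolutely_integrable_norm[unfolded o_def])
  then have "(\<lambda>s. \<bar>s\<bar> ^ k * exp (- s\<^sup>2 / 2)) absolutely_integrable_on (UNIV :: real set)"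
    by (simp add: abs_mult power_abs)
  then show "(\<lambda>s. \<bar>s\<bar> ^ k * exp (- s\<^sup>2 / 2)) absolutely_integrable_on A"
    by (rule set_integrable_subset) (use assms in auto)
qed

lemma gauss_power_integrable:
  fixes A :: "real set"
  shows "A \<in> sets lebesgue \<Longrightarrow> (\<lambda>s. s ^ k * exp (- s\<^sup>2 / 2)) integrable_on A"
  "A \<in> sets lebesgue \<Longrightarrow> (\<lambda>s. \<bar>s\<bar> ^ k * exp (- s\<^sup>2 / 2)) integrable_on A"
  using gauss_power_abs_integrable[of A k] by (auto intro: set_lebesgue_integral_eq_integral(1))

lemma gauss_moment_split: "a \<le> b \<Longrightarrow> gauss_moment k {..b} = gauss_moment k {..a} + gauss_moment k {a..b}"
proof -
  assume "a \<le> b"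
  then have "gauss_moment k ({..a} \<union> {a..b}) = gauss_moment k {..a} + gauss_moment k {a..b}"
    unfolding gauss_moment_def by (intro Henstock_Kurzweil_Integration.integral_Un gauss_power_integrable)
       (auto intro!: negligible_subset[OF negligible_sing[of a]])
  moreover have "{..a} \<union> {a..b} = {..b}" using \<open>a \<le> b\<close> by auto
  ultimately show ?thesis by simp
qed

lemma gauss_moment_has_derivative:
  "((\<lambda>y. gauss_moment k {..y}) has_real_derivative (y ^ k * exp (- y\<^sup>2 / 2))) (at y)"
proof -
  have "((\<lambda>u. integral {y - 1..u} (\<lambda>s. s ^ k * exp (- s\<^sup>2 / 2))) has_real_derivative y ^ k * exp (- y\<^sup>2 / 2))
     (at y within {y - 1..y + 1})"
    by (rule integral_has_real_derivative) (auto intro!: continuous_intros)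
  then have "((\<lambda>u. integral {y - 1..u} (\<lambda>s. s ^ k * exp (- s\<^sup>2 / 2))) has_real_derivative y ^ k * exp (- y\<^sup>2 / 2))
     (at y)"
    by (subst (asm) at_within_interior) auto
  then have "((\<lambda>u. gauss_moment k {..y - 1} + gauss_moment k {y - 1..u}) has_real_derivative y ^ k * exp (- y\<^sup>2 / 2)) (at y)"
    unfolding gauss_moment_def using DERIV_add[OF DERIV_const] by fastforce
  then show ?thesis
    by (rule has_field_derivative_transform_within_open[of _ _ _ "{y - 1<..}"])
       (simp_all add: gauss_moment_split[of "y - 1", symmetric])
qed

lemma gauss_moment_0_strict_mono: "a < b \<Longrightarrow> gauss_moment 0 {..a} < gauss_moment 0 {..b}"
proof (rule DERIV_pos_imp_increasing[of a b])
  show "\<exists>d. ((\<lambda>y. gauss_moment 0 {..y}) has_real_derivative d) (at x) \<and> 0 < d" for x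
    using gauss_moment_has_derivative[of 0 x] by (intro exI[of _ "exp (- x\<^sup>2 / 2)"]) simp
qed

lemma expands_exp: "expands (nhds 0) n exp (\<Sum>i<n. monom (1 / fact i) i)"
  using exp_converges[where 'a = real]
  by (intro expands_power_series[of 1]) (auto simp: divide_inverse mult.commute)

lemma expands_gauss:
  assumes "n \<ge> 1"
  shows "expands (nhds 0) n (\<lambda>h. exp (- (a + h)\<^sup>2 / 2))
     (smult (exp (- a\<^sup>2 / 2)) (pcompose (\<Sum>i<n. monom (1 / fact i) i) [:0, - a, -1/2:]))"
proof -
  have "expands (nhds 0) n (\<lambda>h. exp (poly [:0, - a, -1/2:] h))
      (pcompose (\<Sum>i<n. monom (1 / fact i) i) [:0, - a, -1/2:])"
    by (rule expands_compose[OF nhds_0_refl expands_exp expands_poly[OF nhds_0_refl]]) (use assms in auto)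
  from expands_mult[OF nhds_0_refl expands_const[OF nhds_0_refl, of _ "exp (- a\<^sup>2 / 2)"] this]
  have "expands (nhds 0) n (\<lambda>h. exp (- a\<^sup>2 / 2) * exp (poly [:0, - a, -1/2:] h))
     (smult (exp (- a\<^sup>2 / 2)) (pcompose (\<Sum>i<n. monom (1 / fact i) i) [:0, - a, -1/2:]))"
    by simp
  moreover have "exp (- a\<^sup>2 / 2) * exp (poly [:0, - a, -1/2:] h) = exp (- (a + h)\<^sup>2 / 2)" for h
  proof -
    have "- a\<^sup>2 / 2 + poly [:0, - a, -1/2:] h = - (a + h)\<^sup>2 / 2"
      by (simp add: power2_eq_square field_simps)
    then show ?thesis by (simp only: exp_add[symmetric])
  qed
  ultimately show ?thesis by simp
qed

lemma expands_gauss_moment: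
  assumes "expands (nhds 0) n (\<lambda>h. (a + h) ^ k * exp (- (a + h)\<^sup>2 / 2)) (pderiv p)"
    and "coeff p 0 = gauss_moment k {..a}"
  shows "expands (nhds 0) (Suc n) (\<lambda>h. gauss_moment k {..a + h}) p"
proof (rule expands_antiderivative[OF always_eventually assms(1)])
  have d: "((\<lambda>h. a + h) has_real_derivative 1) (at h)" for h
    by (auto intro!: derivative_eq_intros)
  show "\<forall>h. ((\<lambda>h. gauss_moment k {..a + h}) has_real_derivative (a + h) ^ k * exp (- (a + h)\<^sup>2 / 2)) (at h)"
    using DERIV_chain2[OF gauss_moment_has_derivative d] by simp
qed (use assms(2) in simp)

text \<open>The second coefficient is recorded because it is the nonvanishing derivative that makes the
  moment of order \<open>0\<close> locally invertible.\<close>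

lemma ex_expands_gauss_moment:
  obtains p where "coeff p 0 = gauss_moment k {..a}" "coeff p 1 = a ^ k * exp (- a\<^sup>2 / 2)"
    "expands (nhds 0) n (\<lambda>h. gauss_moment k {..a + h}) p"
proof -
  obtain q where q: "expands (nhds 0) (Suc n) (\<lambda>h. poly ([:a, 1:] ^ k) h * exp (- (a + h)\<^sup>2 / 2)) q"
    using expands_mult[OF nhds_0_refl expands_poly[OF nhds_0_refl, of _ "[:a, 1:] ^ k"] expands_gauss[of "Suc n" a]] that by simp
  obtain p where p: "pderiv p = q" "coeff p 0 = gauss_moment k {..a}" using ex_poly_antiderivative by blast
  have "expands (nhds 0) (Suc (Suc n)) (\<lambda>h. gauss_moment k {..a + h}) p"
    using q p by (intro expands_gauss_moment) (simp_all add: poly_power)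
  moreover have "coeff p 1 = coeff (pderiv p) 0" by (simp add: coeff_pderiv)
  then have "coeff p 1 = a ^ k * exp (- a\<^sup>2 / 2)"
    using expands_at_0[OF q] by (simp add: p(1) poly_power flip: poly_0_coeff_0)
  ultimately show ?thesis using that p(2) expands_mono[OF nhds_0_refl, of "Suc (Suc n)" _ _ n] by simp
qed

lemma gauss_moment_union_tail: "gauss_moment k UNIV = gauss_moment k {..a} + gauss_moment k {a..}"
proof -
  have "gauss_moment k ({..a} \<union> {a..}) = gauss_moment k {..a} + gauss_moment k {a..}"
    unfolding gauss_moment_def by (intro Henstock_Kurzweil_Integration.integral_Un gauss_power_integrable)
       (auto intro!: negligible_subset[OF negligible_sing[of a]])
  moreover have "{..a} \<union> {a..} = UNIV" by auto
  ultimately show ?thesis by simp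
qed

lemma gauss_moment_0_reflect: "gauss_moment 0 {..- a} = gauss_moment 0 {a..}"
proof -
  define f :: "real \<Rightarrow> real" where "f s = s ^ 0 * exp (- s\<^sup>2 / 2)" for s
  have "f absolutely_integrable_on (uminus ` {a..}) \<and> integral (uminus ` {a..}) f = gauss_moment 0 {a..}"
  proof (subst has_absolute_integral_change_of_variables_1'[symmetric, where g' = "\<lambda>_. - 1"])
    show "(uminus has_real_derivative - 1) (at x within {a..})" for x :: real
      by (auto intro!: derivative_eq_intros)
    show "(\<lambda>x. \<bar>- 1\<bar> * f (- x)) absolutely_integrable_on {a..} \<and>
        integral {a..} (\<lambda>x. \<bar>- 1\<bar> * f (- x)) = gauss_moment 0 {a..}"
      using gauss_power_abs_integrable(1)[of "{a..}" 0] by (simp add: f_def[abs_def] gauss_moment_def)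
  qed auto
  moreover have "uminus ` {a..} = {..- a}" by simp
  ultimately show ?thesis by (simp add: gauss_moment_def f_def[abs_def])
qed

lemma gauss_moment_0_UNIV: "gauss_moment 0 UNIV = sqrt (2 * pi)"
proof -
  have "integrable lborel (\<lambda>s. sqrt (2 * pi) * std_normal_density s)"
    "(LBINT s. sqrt (2 * pi) * std_normal_density s) = sqrt (2 * pi)"
    using integral_std_normal_moment_even[of 0] integrable_std_normal_moment[of 0] by simp_all
  then have "integrable lborel (\<lambda>s. exp (- s\<^sup>2 / 2) :: real)" "(LBINT s. exp (- s\<^sup>2 / 2)) = sqrt (2 * pi)"
    by (simp_all add: std_normal_density_def)
  then have "((\<lambda>s. exp (- s\<^sup>2 / 2)) has_integral sqrt (2 * pi)) UNIV"
    using has_integral_integral_lborel by metis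
  then show ?thesis by (simp add: gauss_moment_def integral_unique)
qed

text \<open>The defining integral of the Gaussian quantile starts at \<open>0\<close>; by symmetry of the density it
  is the condition that \<open>- L\<close> cuts off the fraction \<open>p\<close> of the total mass on the left.\<close>

lemma gauss_moment_0_quantile:
  assumes "0 < p" "p < 1"
  shows "gauss_moment 0 {..- gauss_upper_quantile p} = p * gauss_moment 0 UNIV"
proof -
  define L where "L = gauss_upper_quantile p"
  let ?g = "\<lambda>s::real. exp (- s\<^sup>2 / 2)"
  have L: "(LBINT s=0..L. ?g s) = (1 - 2 * p) * sqrt (pi / 2)"
    using is_gauss_upper_quantile_gauss_upper_quantile[OF assms] by (simp add: is_gauss_upper_quantile_def L_def)
  have si: "set_integrable lborel {a..b} ?g" for a b
    by (intro borel_integrable_atLeastAtMost') (auto intro!: continuous_intros)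
  have ii: "(LBINT s=a..b. ?g s) = gauss_moment 0 {a..b}" if "a \<le> b" for a b :: real
    using interval_integral_eq_integral[OF that si] by (simp add: gauss_moment_def)
  have "(LBINT s=0..L. ?g s) = gauss_moment 0 {..L} - gauss_moment 0 {..0}"
  proof (cases "L \<ge> 0")
    case True
    then show ?thesis using ii[of 0 L] gauss_moment_split[of 0 L 0] by (simp add: zero_ereal_def)
  next
    case False
    then have "(LBINT s=0..L. ?g s) = - (LBINT s=L..0. ?g s)"
      by (simp add: interval_integral_endpoints_reverse[of "0::ereal" "ereal L"])
    then show ?thesis using False ii[of L 0] gauss_moment_split[of L 0 0] by (simp add: zero_ereal_def)
  qed
  moreover have "gauss_moment 0 {..0} = sqrt (2 * pi) / 2"
    using gauss_moment_0_reflect[of 0] gauss_moment_union_tail[of 0 0] gauss_moment_0_UNIV by simp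
  moreover have "gauss_moment 0 {..- L} = sqrt (2 * pi) - gauss_moment 0 {..L}"
    using gauss_moment_0_reflect[of L] gauss_moment_union_tail[of 0 L] gauss_moment_0_UNIV by simp
  moreover have "sqrt (pi / 2) = sqrt (2 * pi) / 2"
    by (simp add: real_sqrt_divide real_sqrt_mult field_simps)
  ultimately show ?thesis using L unfolding gauss_moment_0_UNIV L_def by (simp add: algebra_simps)
qed

lemma gauss_moment_tendsto:
  "(\<lambda>n. gauss_moment k {..- real n}) \<longlonglongrightarrow> 0" "(\<lambda>n. gauss_moment k {..real n}) \<longlonglongrightarrow> gauss_moment k UNIV"
proof -
  let ?f = "\<lambda>s::real. s ^ k * exp (- s\<^sup>2 / 2)"
  have r: "gauss_moment k A = integral UNIV (\<lambda>s. if s \<in> A then ?f s else 0)" for A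
    by (simp add: gauss_moment_def integral_restrict_UNIV)
  have gen: "(\<lambda>n. gauss_moment k (A n)) \<longlonglongrightarrow> integral UNIV g"
    if A: "\<And>n. A n \<in> sets lebesgue" and l: "\<And>s. (\<lambda>n. if s \<in> A n then ?f s else 0) \<longlonglongrightarrow> g s" for A :: "nat \<Rightarrow> real set" and g
    unfolding r
  proof (rule dominated_convergence(2)[where h = "\<lambda>s. \<bar>s\<bar> ^ k * exp (- s\<^sup>2 / 2)"])
    show "(\<lambda>s. if s \<in> A n then ?f s else 0) integrable_on UNIV" for n
      using gauss_power_integrable(1)[OF A] by (simp add: integrable_restrict_UNIV)
    show "(\<lambda>s::real. \<bar>s\<bar> ^ k * exp (- s\<^sup>2 / 2)) integrable_on UNIV"
      by (rule gauss_power_integrable) simp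
  qed (use l in \<open>auto simp: abs_mult power_abs\<close>)
  show "(\<lambda>n. gauss_moment k {..- real n}) \<longlonglongrightarrow> 0"
  proof -
    have "(\<lambda>n. if s \<in> {..- real n} then ?f s else 0) \<longlonglongrightarrow> 0" for s
    proof (rule tendsto_eventually)
      show "\<forall>\<^sub>F n in sequentially. (if s \<in> {..- real n} then ?f s else 0) = 0"
        using eventually_gt_at_top[of "nat \<lceil>\<bar>s\<bar>\<rceil>"]
      proof eventually_elim
        case (elim n)
        have "\<bar>s\<bar> < real n" using elim by linarith
        then show ?case by auto
      qed
    qed
    from gen[OF _ this] show ?thesis by simp
  qed
  show "(\<lambda>n. gauss_moment k {..real n}) \<longlonglongrightarrow> gauss_moment k UNIV"
  proof -
    have "(\<lambda>n. if s \<in> {..real n} then ?f s else 0) \<longlonglongrightarrow> ?f s" for s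
    proof (rule tendsto_eventually)
      show "\<forall>\<^sub>F n in sequentially. (if s \<in> {..real n} then ?f s else 0) = ?f s"
        using eventually_gt_at_top[of "nat \<lceil>\<bar>s\<bar>\<rceil>"]
      proof eventually_elim
        case (elim n)
        have "\<bar>s\<bar> < real n" using elim by linarith
        then show ?case by auto
      qed
    qed
    from gen[OF _ this] show ?thesis by (simp add: gauss_moment_def)
  qed
qed

text \<open>Used as integration by parts from \<open>-\<infinity>\<close>: \<open>G\<close> is a partial moment minus its closed form, which
  avoids boundary terms of improper integrals.\<close>

lemma eq_0_if_derivative_0_and_vanishes_at_bot:
  assumes d: "\<And>y. (G has_real_derivative 0) (at y)"
    and l: "(\<lambda>n. G (- real n)) \<longlonglongrightarrow> 0"
  shows "G y = 0"
proof -
  have c: "G u = G v" for u v using DERIV_isconst_all[of G u v] d by blast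
  have "(\<lambda>n. G (- real n)) = (\<lambda>_. G y)" using c by blast
  then have "(\<lambda>n. G (- real n)) \<longlonglongrightarrow> G y" by simp
  from LIMSEQ_unique[OF this l] show ?thesis .
qed

lemma gauss_moment_1: "gauss_moment 1 {..y} = - exp (- y\<^sup>2 / 2)"
proof -
  have "gauss_moment 1 {..y} + exp (- y\<^sup>2 / 2) = 0"
  proof (rule eq_0_if_derivative_0_and_vanishes_at_bot[where G = "\<lambda>y. gauss_moment 1 {..y} + exp (- y\<^sup>2 / 2)"])
    show "((\<lambda>y. gauss_moment 1 {..y} + exp (- y\<^sup>2 / 2)) has_real_derivative 0) (at y)" for y
      using gauss_moment_has_derivative[of 1 y] by (auto intro!: derivative_eq_intros)
    have "(\<lambda>n. exp (- (- real n)\<^sup>2 / 2)) \<longlonglongrightarrow> 0" by real_asymp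
    from tendsto_add[OF gauss_moment_tendsto(1)[of 1] this]
    show "(\<lambda>n. gauss_moment 1 {..- real n} + exp (- (- real n)\<^sup>2 / 2)) \<longlonglongrightarrow> 0" by simp
  qed
  then show ?thesis by simp
qed

lemma gauss_moment_2: "gauss_moment 2 {..y} = gauss_moment 0 {..y} - y * exp (- y\<^sup>2 / 2)"
proof -
  have "gauss_moment 2 {..y} - gauss_moment 0 {..y} + y * exp (- y\<^sup>2 / 2) = 0"
  proof (rule eq_0_if_derivative_0_and_vanishes_at_bot[where G = "\<lambda>y. gauss_moment 2 {..y} - gauss_moment 0 {..y} + y * exp (- y\<^sup>2 / 2)"])
    show "((\<lambda>y. gauss_moment 2 {..y} - gauss_moment 0 {..y} + y * exp (- y\<^sup>2 / 2)) has_real_derivative 0) (at y)" for y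
      using gauss_moment_has_derivative[of 2 y] gauss_moment_has_derivative[of 0 y]
      by (auto intro!: derivative_eq_intros simp: power2_eq_square algebra_simps)
    have "(\<lambda>n. - real n * exp (- (- real n)\<^sup>2 / 2)) \<longlonglongrightarrow> 0" by real_asymp
    from tendsto_add[OF tendsto_diff[OF gauss_moment_tendsto(1)[of 2] gauss_moment_tendsto(1)[of 0]] this]
    show "(\<lambda>n. gauss_moment 2 {..- real n} - gauss_moment 0 {..- real n} + - real n * exp (- (- real n)\<^sup>2 / 2)) \<longlonglongrightarrow> 0" by simp
  qed
  then show ?thesis by simp
qed

lemma gauss_moment_1_UNIV: "gauss_moment 1 UNIV = 0"
proof -
  have "(\<lambda>n. - exp (- (real n)\<^sup>2 / 2)) \<longlonglongrightarrow> 0" by real_asymp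
  then show ?thesis using gauss_moment_tendsto(2)[of 1] unfolding gauss_moment_1 by (rule LIMSEQ_unique[rotated])
qed

lemma gauss_moment_2_UNIV: "gauss_moment 2 UNIV = gauss_moment 0 UNIV"
proof -
  have "(\<lambda>n. real n * exp (- (real n)\<^sup>2 / 2)) \<longlonglongrightarrow> 0" by real_asymp
  from tendsto_diff[OF gauss_moment_tendsto(2)[of 0] this]
  have "(\<lambda>n. gauss_moment 2 {..real n}) \<longlonglongrightarrow> gauss_moment 0 UNIV" unfolding gauss_moment_2 by simp
  with gauss_moment_tendsto(2)[of 2] show ?thesis by (rule LIMSEQ_unique)
qed

section \<open>The gamma integral as a perturbed Gaussian integral\<close>

text \<open>Watson's lemma in this setting: integrate the global bound for \<open>weight\<close> at \<open>\<epsilon> s\<close> against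
  the Gaussian.\<close>

lemma weighted_gauss_integral:
  assumes bound: "\<And>y. \<bar>weight y - poly p y\<bar> \<le> C * \<bar>y\<bar> ^ n"
    and int: "(\<lambda>s. exp (- s\<^sup>2 / 2) * weight (\<epsilon> * s)) integrable_on A"
    and A: "A \<in> sets lebesgue" and eps: "\<epsilon> > 0"
  shows "\<bar>integral A (\<lambda>s. exp (- s\<^sup>2 / 2) * weight (\<epsilon> * s)) - (\<Sum>k\<le>degree p. coeff p k * \<epsilon> ^ k * gauss_moment k A)\<bar>
           \<le> C * integral A (\<lambda>s. \<bar>s\<bar> ^ n * exp (- s\<^sup>2 / 2)) * \<epsilon> ^ n"
proof -
  let ?q = "\<lambda>s. \<Sum>k\<le>degree p. (coeff p k * \<epsilon> ^ k) * (s ^ k * exp (- s\<^sup>2 / 2))"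
  have q: "?q s = exp (- s\<^sup>2 / 2) * poly p (\<epsilon> * s)" for s
    by (simp add: poly_altdef sum_distrib_left power_mult_distrib mult_ac)
  have iq: "?q integrable_on A"
    by (intro integrable_sum integrable_on_mult_right gauss_power_integrable A) auto
  have "integral A ?q = (\<Sum>k\<le>degree p. coeff p k * \<epsilon> ^ k * gauss_moment k A)"
    unfolding gauss_moment_def
    by (subst Henstock_Kurzweil_Integration.integral_sum)
       (auto intro!: integrable_on_mult_right gauss_power_integrable(1)[OF A, simplified])
  then have "integral A (\<lambda>s. exp (- s\<^sup>2 / 2) * weight (\<epsilon> * s)) - (\<Sum>k\<le>degree p. coeff p k * \<epsilon> ^ k * gauss_moment k A)
     = integral A (\<lambda>s. exp (- s\<^sup>2 / 2) * weight (\<epsilon> * s) - ?q s)"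
    using Henstock_Kurzweil_Integration.integral_diff[OF int iq] by simp
  moreover have "norm (integral A (\<lambda>s. exp (- s\<^sup>2 / 2) * weight (\<epsilon> * s) - ?q s))
      \<le> integral A (\<lambda>s. (C * \<epsilon> ^ n) * (\<bar>s\<bar> ^ n * exp (- s\<^sup>2 / 2)))"
  proof (rule Henstock_Kurzweil_Integration.integral_norm_bound_integral)
    show "(\<lambda>s. exp (- s\<^sup>2 / 2) * weight (\<epsilon> * s) - ?q s) integrable_on A"
      using int iq by (rule Henstock_Kurzweil_Integration.integrable_diff)
    show "(\<lambda>s. (C * \<epsilon> ^ n) * (\<bar>s\<bar> ^ n * exp (- s\<^sup>2 / 2))) integrable_on A"
      by (intro integrable_on_mult_right gauss_power_integrable A)
    fix s
    have "\<bar>exp (- s\<^sup>2 / 2) * weight (\<epsilon> * s) - ?q s\<bar> = exp (- s\<^sup>2 / 2) * \<bar>weight (\<epsilon> * s) - poly p (\<epsilon> * s)\<bar>"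
      unfolding q by (simp add: abs_mult flip: right_diff_distrib)
    also have "\<dots> \<le> exp (- s\<^sup>2 / 2) * (C * \<bar>\<epsilon> * s\<bar> ^ n)" by (intro mult_left_mono bound) simp
    also have "\<dots> = (C * \<epsilon> ^ n) * (\<bar>s\<bar> ^ n * exp (- s\<^sup>2 / 2))"
      using eps by (simp add: abs_mult power_mult_distrib)
    finally show "norm (exp (- s\<^sup>2 / 2) * weight (\<epsilon> * s) - ?q s) \<le> (C * \<epsilon> ^ n) * (\<bar>s\<bar> ^ n * exp (- s\<^sup>2 / 2))"
      by simp
  qed
  moreover have "integral A (\<lambda>s. (C * \<epsilon> ^ n) * (\<bar>s\<bar> ^ n * exp (- s\<^sup>2 / 2)))
      = C * integral A (\<lambda>s. \<bar>s\<bar> ^ n * exp (- s\<^sup>2 / 2)) * \<epsilon> ^ n"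
    by simp
  ultimately show ?thesis by (simp only: real_norm_def)
qed

text \<open>The exponent transforms by
  \<open>(sqrt x * eta (t/x - 1))\<^sup>2 / 2 = t - x - x * ln (t/x)\<close>. The point \<open>t = x\<close> is removed because there the
  formula \<open>w / ((1 + w) * eta w)\<close> for the derivative of \<open>eta\<close> reads \<open>0 / 0\<close>.\<close>

lemma gamma_substitution:
  fixes x :: real and S :: "real set"
  assumes x: "x > 0" and S: "S \<in> sets lebesgue" "S \<subseteq> {0<..} - {x}"
    and int: "(\<lambda>t. exp (- t) * t powr (x - 1)) absolutely_integrable_on S"
  defines "T \<equiv> (\<lambda>t. sqrt x * eta (t / x - 1)) ` S"
  shows "(\<lambda>s. exp (- s\<^sup>2 / 2) * weight (1 / sqrt x * s)) absolutely_integrable_on T"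
    and "integral T (\<lambda>s. exp (- s\<^sup>2 / 2) * weight (1 / sqrt x * s))
          = (sqrt x * exp x / x powr x) * integral S (\<lambda>t. exp (- t) * t powr (x - 1))"
proof -
  define k where "k t = sqrt x * eta (t / x - 1)" for t
  define k' where "k' t = sqrt x * ((t / x - 1) / ((1 + (t / x - 1)) * eta (t / x - 1)) * (1 / x))" for t
  define f where "f s = exp (- s\<^sup>2 / 2) * weight (1 / sqrt x * s)" for s
  define c where "c = sqrt x * exp x / x powr x"
  have S0: "t > 0" "t \<noteq> x" if "t \<in> S" for t using S(2) that by auto
  have w: "t / x - 1 > -1" if "t \<in> S" for t using S0[OF that] x by (simp add: field_simps)
  have w0: "t / x - 1 \<noteq> 0" if "t \<in> S" for t using S0[OF that] x by (simp add: field_simps)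
  have der: "(k has_field_derivative k' t) (at t within S)" if t: "t \<in> S" for t
  proof -
    have "((\<lambda>t. t / x - 1) has_real_derivative 1 / x) (at t within S)"
      using x by (auto intro!: derivative_eq_intros)
    from DERIV_chain2[OF eta_has_derivative[OF w[OF t] w0[OF t]] this]
    show ?thesis unfolding k_def[abs_def] k'_def by (rule DERIV_cmult)
  qed
  have inj: "inj_on k S"
  proof (rule inj_onI)
    fix a b assume "a \<in> S" "b \<in> S" "k a = k b"
    then have "eta (a / x - 1) = eta (b / x - 1)" using x by (simp add: k_def)
    then have "a / x - 1 = b / x - 1" by (rule eta_inj[OF w[OF \<open>a \<in> S\<close>] w[OF \<open>b \<in> S\<close>]])
    then show "a = b" using x by simp
  qed
  have eq: "\<bar>k' t\<bar> * f (k t) = c * (exp (- t) * t powr (x - 1))" if t: "t \<in> S" for t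
  proof -
    define v where "v = t / x - 1"
    have v: "v > -1" "v \<noteq> 0" using w[OF t] w0[OF t] by (simp_all add: v_def)
    have en: "eta v \<noteq> 0" using eta_pos_iff[OF v(1)] eta_neg_iff[OF v(1)] v(2) by auto
    have wt: "weight (eta v) = eta v / v" using weight_eta[OF v(1)] v(2) by (simp add: field_simps)
    have t1: "1 + v = t / x" by (simp add: v_def)
    have pos: "v / ((1 + v) * eta v) > 0"
    proof -
      have "v / eta v > 0" using wt weight_pos[of "eta v"] by (metis inverse_divide positive_imp_inverse_positive)
      then have "(v / eta v) / (1 + v) > 0" by (rule divide_pos_pos) (use v(1) in simp)
      then show ?thesis by (simp only: divide_divide_eq_left mult.commute)
    qed
    have kt: "k' t = sqrt x * (v / ((1 + v) * eta v) * (1 / x))" by (simp add: k'_def v_def)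
    have k': "\<bar>k' t\<bar> = sqrt x * (v / ((1 + v) * eta v) * (1 / x))"
    proof -
      have "0 < sqrt x * (v / ((1 + v) * eta v) * (1 / x))"
        by (intro mult_pos_pos pos) (use x in simp_all)
      with kt show ?thesis by (simp only: abs_of_pos)
    qed
    have "- (k t)\<^sup>2 / 2 = - x * (v - ln (t / x))"
      using eta_squared[OF v(1)] x by (simp add: k_def v_def power_mult_distrib)
    also have "\<dots> = - t + x + x * (ln t - ln x)"
      using x S0[OF t] by (simp add: ln_div v_def field_simps)
    finally have ex: "exp (- (k t)\<^sup>2 / 2) = exp (- t) * exp x * (t powr x / x powr x)"
      using x S0[OF t] by (simp add: exp_add[symmetric] exp_diff[symmetric] powr_def algebra_simps)
    have arg: "1 / sqrt x * k t = eta v" using x by (simp add: k_def v_def)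
    have "\<bar>k' t\<bar> * f (k t) = sqrt x * (v / ((1 + v) * eta v) * (1 / x)) * (exp (- t) * exp x * (t powr x / x powr x) * (eta v / v))"
      unfolding f_def k' ex arg wt ..
    also have "\<dots> = sqrt x * exp x / x powr x * (exp (- t) * (t powr x / t))"
      using en v x S0[OF t] unfolding t1 by (simp add: field_simps)
    also have "t powr x / t = t powr (x - 1)" using S0[OF t] by (simp add: powr_diff)
    finally show ?thesis by (simp add: c_def)
  qed
  have "(\<lambda>t. c * (exp (- t) * t powr (x - 1))) absolutely_integrable_on S"
    using int by (rule set_integrable_mult_right)
  then have "(\<lambda>t. \<bar>k' t\<bar> * f (k t)) absolutely_integrable_on S"
    by (rule set_integrable_cong[THEN iffD1, rotated -1]) (auto simp: eq)
  moreover have "integral S (\<lambda>t. \<bar>k' t\<bar> * f (k t)) = c * integral S (\<lambda>t. exp (- t) * t powr (x - 1))"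
  proof -
    have "integral S (\<lambda>t. \<bar>k' t\<bar> * f (k t)) = integral S (\<lambda>t. c * (exp (- t) * t powr (x - 1)))"
      by (rule Henstock_Kurzweil_Integration.integral_cong) (rule eq)
    then show ?thesis by simp
  qed
  ultimately have *: "f absolutely_integrable_on (k ` S) \<and>
      integral (k ` S) f = c * integral S (\<lambda>t. exp (- t) * t powr (x - 1))"
    using has_absolute_integral_change_of_variables_1'[OF S(1) der inj, of f "c * integral S (\<lambda>t. exp (- t) * t powr (x - 1))"] by blast
  have T: "T = k ` S" by (simp add: T_def k_def)
  from * show "(\<lambda>s. exp (- s\<^sup>2 / 2) * weight (1 / sqrt x * s)) absolutely_integrable_on T"
    and "integral T (\<lambda>s. exp (- s\<^sup>2 / 2) * weight (1 / sqrt x * s))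
          = (sqrt x * exp x / x powr x) * integral S (\<lambda>t. exp (- t) * t powr (x - 1))"
    unfolding T f_def[abs_def] c_def by blast+
qed

text \<open>The substitution is applied to \<open>{0<..}\<close> and to \<open>{0<..m}\<close>, up to the null sets \<open>{x}\<close> and \<open>{0}\<close>;
  the constant factor is the same in both cases and cancels.\<close>

lemma gamma_quantile_equation:
  assumes p: "0 < p" "p < 1" and x: "x > 0"
  defines "Y \<equiv> sqrt x * eta (gamma_quantile p x / x - 1)"
  shows "(\<lambda>s. exp (- s\<^sup>2 / 2) * weight (1 / sqrt x * s)) absolutely_integrable_on UNIV"
    and "integral {..Y} (\<lambda>s. exp (- s\<^sup>2 / 2) * weight (1 / sqrt x * s))
          = p * integral UNIV (\<lambda>s. exp (- s\<^sup>2 / 2) * weight (1 / sqrt x * s))"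
proof -
  define m where "m = gamma_quantile p x"
  let ?g = "\<lambda>t. exp (- t) * t powr (x - 1)"
  let ?f = "\<lambda>s. exp (- s\<^sup>2 / 2) * weight (1 / sqrt x * s)"
  let ?c = "sqrt x * exp x / x powr x"
  define k where "k t = sqrt x * eta (t / x - 1)" for t
  have m: "m > 0" "(LBINT t=0..m. ?g t) = p * Gamma x"
    using is_gamma_quantile_gamma_quantile[OF p x] by (simp_all add: is_gamma_quantile_def m_def)
  have hi: "(?g has_integral Gamma x) {0..}"
  proof -
    have "(\<lambda>t::real. t powr (x - 1) / exp t) = ?g" by (auto simp: exp_minus field_simps)
    then show ?thesis using Gamma_integral_real[OF x] by simp
  qed
  have ai: "?g absolutely_integrable_on {0..}"
    by (rule nonnegative_absolutely_integrable_1) (use hi in \<open>auto simp: has_integral_iff\<close>)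
  then have "set_integrable lborel {0..} ?g"
    unfolding set_integrable_def by (subst (asm) integrable_completion) auto
  then have "set_integrable lborel {0..m} ?g" by (rule set_integrable_subset) auto
  then have im: "integral {0..m} ?g = p * Gamma x"
    using m interval_integral_eq_integral[of 0 m ?g] by (simp add: zero_ereal_def)
  have k_less: "k a < k b \<longleftrightarrow> a < b" if "a > 0" "b > 0" for a b
    using eta_less_iff[of "a / x - 1" "b / x - 1"] that x by (simp add: k_def field_simps)
  have k_x: "k x = 0" using x by (simp add: k_def)
  have k_surj: "\<exists>t>0. k t = s" for s
  proof (intro exI conjI)
    show "x * (1 + eta_inv (s / sqrt x)) > 0" using x eta_inv(1)[of "s / sqrt x"] by simp
    show "k (x * (1 + eta_inv (s / sqrt x))) = s" using x by (simp add: k_def eta_inv)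
  qed
  have neg: "negligible {x}" by simp
  have img: "k ` (S - {x}) = k ` S - {0}" if "S \<subseteq> {0<..}" for S
  proof -
    have "inj_on k {0<..}"
      by (rule inj_onI) (metis greaterThan_iff k_less linorder_neqE_linordered_idom order_less_irrefl)
    then show ?thesis using inj_on_image_set_diff[of k "{0<..}" S "{x}"] that x k_x by auto
  qed
  have gen: "?f absolutely_integrable_on k ` S \<and> integral (k ` S) ?f = ?c * integral S ?g"
    if S: "S \<in> sets lebesgue" "S \<subseteq> {0<..}" for S
  proof -
    have "?g absolutely_integrable_on (S - {x})"
      by (rule set_integrable_subset[OF ai]) (use S in auto)
    note * = gamma_substitution[OF x _ _ this, folded k_def]
    have S': "S - {x} \<in> sets lebesgue" "S - {x} \<subseteq> {0<..} - {x}" using S by auto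
    have "?f absolutely_integrable_on (k ` S - {0})" "integral (k ` S - {0}) ?f = ?c * integral (S - {x}) ?g"
      using *[OF S'] by (simp_all only: img[OF S(2)])
    moreover have "integral (S - {x}) ?g = integral S ?g"
      by (rule integral_subset_negligible) (auto intro: negligible_subset[OF neg])
    moreover have "integral (k ` S - {0}) ?f = integral (k ` S) ?f"
      by (rule integral_subset_negligible) (auto intro: negligible_subset[of "{0}"])
    moreover have "?f absolutely_integrable_on (k ` S - {0}) \<longleftrightarrow> ?f absolutely_integrable_on (k ` S)"
      by (rule absolutely_integrable_spike_set_eq) (auto intro: negligible_subset[of "{0}"])
    ultimately show ?thesis by simp
  qed
  have "s \<in> k ` {0<..}" for s
    using k_surj[of s] by (metis greaterThan_iff imageI)
  then have kU: "k ` {0<..} = UNIV" by blast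
  have U: "?f absolutely_integrable_on UNIV" "integral UNIV ?f = ?c * integral {0<..} ?g"
    using gen[of "{0<..}"] unfolding kU by simp_all
  have "integral {0<..} ?g = integral {0..} ?g"
    by (rule integral_subset_negligible) (auto intro: negligible_subset[of "{0}"])
  then have U': "integral UNIV ?f = ?c * Gamma x" using U(2) hi by (simp add: integral_unique)
  have "k ` {0<..m} = {..k m}"
  proof safe
    fix t assume "t \<in> {0<..m}" then show "k t \<le> k m" using k_less[of m t] m(1) by auto
  next
    fix s assume "s \<le> k m"
    obtain t where "t > 0" "k t = s" using k_surj by blast
    then show "s \<in> k ` {0<..m}" using \<open>s \<le> k m\<close> k_less[of m t] m(1) by (intro image_eqI[of _ _ t]) auto
  qed
  moreover have "{0<..m} \<subseteq> {0<..}" by auto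
  ultimately have "integral {..k m} ?f = ?c * integral {0<..m} ?g"
    using gen[of "{0<..m}"] by simp
  also have "integral {0<..m} ?g = integral {0..m} ?g"
    by (rule integral_subset_negligible) (auto intro: negligible_subset[of "{0}"])
  also have "?c * \<dots> = p * integral UNIV ?f" using im U' by simp
  finally show "integral {..Y} ?f = p * integral UNIV ?f" by (simp add: Y_def k_def m_def)
  show "?f absolutely_integrable_on UNIV" by (rule U(1))
qed

section \<open>Expansion of the scaled quantile\<close>

text \<open>The coordinate \<open>Y \<epsilon>\<close> of the quantile at \<open>x = 1 / \<epsilon>\<^sup>2\<close>.\<close>

definition scaled_quantile :: "real \<Rightarrow> real \<Rightarrow> real" where
  "scaled_quantile p \<epsilon> = 1 / \<epsilon> * eta (\<epsilon>\<^sup>2 * gamma_quantile p (1 / \<epsilon>\<^sup>2) - 1)"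

lemma scaled_quantile_equation:
  assumes "0 < p" "p < 1" "\<epsilon> > 0"
  shows "(\<lambda>s. exp (- s\<^sup>2 / 2) * weight (\<epsilon> * s)) absolutely_integrable_on UNIV"
    and "integral {..scaled_quantile p \<epsilon>} (\<lambda>s. exp (- s\<^sup>2 / 2) * weight (\<epsilon> * s))
          = p * integral UNIV (\<lambda>s. exp (- s\<^sup>2 / 2) * weight (\<epsilon> * s))"
proof -
  have x: "1 / \<epsilon>\<^sup>2 > 0" using assms by simp
  have s: "sqrt (1 / \<epsilon>\<^sup>2) = 1 / \<epsilon>" using assms by (simp add: real_sqrt_divide)
  have m: "gamma_quantile p (1 / \<epsilon>\<^sup>2) / (1 / \<epsilon>\<^sup>2) = \<epsilon>\<^sup>2 * gamma_quantile p (1 / \<epsilon>\<^sup>2)" by simp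
  have e: "1 / (1 / \<epsilon>) = \<epsilon>" by simp
  note * = gamma_quantile_equation[OF assms(1,2) x, unfolded s m e, folded scaled_quantile_def]
  show "(\<lambda>s. exp (- s\<^sup>2 / 2) * weight (\<epsilon> * s)) absolutely_integrable_on UNIV"
    and "integral {..scaled_quantile p \<epsilon>} (\<lambda>s. exp (- s\<^sup>2 / 2) * weight (\<epsilon> * s))
          = p * integral UNIV (\<lambda>s. exp (- s\<^sup>2 / 2) * weight (\<epsilon> * s))"
    by (rule *)+
qed

lemma truncated_quantile_equation:
  assumes p: "0 < p" "p < 1" and P: "expands (nhds 0) n weight P" "n \<ge> 1" "degree P \<le> n"
  shows "(\<lambda>\<epsilon>. \<Sum>k\<le>degree P. coeff P k * \<epsilon> ^ k * (gauss_moment k {..scaled_quantile p \<epsilon>} - p * gauss_moment k UNIV))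
           \<in> O[at_right 0](\<lambda>\<epsilon>. \<epsilon> ^ n)"
proof -
  obtain C where C: "\<And>y. \<bar>weight y - poly P y\<bar> \<le> C * \<bar>y\<bar> ^ n"
    using weight_global_bound[OF P] by blast
  have C0: "C \<ge> 0" using C[of 1] by simp
  define K where "K = integral UNIV (\<lambda>s::real. \<bar>s\<bar> ^ n * exp (- s\<^sup>2 / 2))"
  define S where "S A \<epsilon> = (\<Sum>k\<le>degree P. coeff P k * \<epsilon> ^ k * gauss_moment k A)" for A and \<epsilon> :: real
  have bound: "\<bar>integral A (\<lambda>s. exp (- s\<^sup>2 / 2) * weight (\<epsilon> * s)) - S A \<epsilon>\<bar> \<le> C * K * \<epsilon> ^ n"
    if A: "A \<in> sets lebesgue" and e: "\<epsilon> > 0" for A \<epsilon>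
  proof -
    have "(\<lambda>s. exp (- s\<^sup>2 / 2) * weight (\<epsilon> * s)) integrable_on A"
      by (rule set_lebesgue_integral_eq_integral(1)[OF set_integrable_subset[OF scaled_quantile_equation(1)[OF p e]]])
         (use A in auto)
    from weighted_gauss_integral[OF C this A e]
    have "\<bar>integral A (\<lambda>s. exp (- s\<^sup>2 / 2) * weight (\<epsilon> * s)) - S A \<epsilon>\<bar>
      \<le> C * integral A (\<lambda>s. \<bar>s\<bar> ^ n * exp (- s\<^sup>2 / 2)) * \<epsilon> ^ n" by (simp only: S_def)
    also have "integral A (\<lambda>s. \<bar>s\<bar> ^ n * exp (- s\<^sup>2 / 2)) \<le> K"
      unfolding K_def by (intro integral_subset_le gauss_power_integrable A) auto
    then have "C * integral A (\<lambda>s. \<bar>s\<bar> ^ n * exp (- s\<^sup>2 / 2)) * \<epsilon> ^ n \<le> C * K * \<epsilon> ^ n"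
      using C0 e by (intro mult_right_mono mult_left_mono) auto
    finally show ?thesis .
  qed
  have "norm (\<Sum>k\<le>degree P. coeff P k * \<epsilon> ^ k * (gauss_moment k {..scaled_quantile p \<epsilon>} - p * gauss_moment k UNIV))
      \<le> (C * K * (1 + p)) * norm (\<epsilon> ^ n)" if e: "\<epsilon> > 0" for \<epsilon>
  proof -
    let ?I = "\<lambda>A. integral A (\<lambda>s. exp (- s\<^sup>2 / 2) * weight (\<epsilon> * s))"
    let ?Y = "{..scaled_quantile p \<epsilon>}"
    have "(\<Sum>k\<le>degree P. coeff P k * \<epsilon> ^ k * (gauss_moment k ?Y - p * gauss_moment k UNIV)) = S ?Y \<epsilon> - p * S UNIV \<epsilon>"
      by (simp add: S_def sum_distrib_left sum_subtractf algebra_simps)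
    also have "\<dots> = p * (?I UNIV - S UNIV \<epsilon>) - (?I ?Y - S ?Y \<epsilon>)"
      unfolding scaled_quantile_equation(2)[OF p e] by (simp add: algebra_simps)
    finally have "\<bar>\<Sum>k\<le>degree P. coeff P k * \<epsilon> ^ k * (gauss_moment k ?Y - p * gauss_moment k UNIV)\<bar>
        \<le> \<bar>p * (?I UNIV - S UNIV \<epsilon>)\<bar> + \<bar>?I ?Y - S ?Y \<epsilon>\<bar>"
      using abs_triangle_ineq4 by (simp only:)
    moreover have "\<bar>p * (?I UNIV - S UNIV \<epsilon>)\<bar> = p * \<bar>?I UNIV - S UNIV \<epsilon>\<bar>"
      using p by (simp only: abs_mult abs_of_pos)
    moreover have "p * \<bar>?I UNIV - S UNIV \<epsilon>\<bar> \<le> p * (C * K * \<epsilon> ^ n)"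
      using p by (intro mult_left_mono bound e) auto
    moreover have "\<bar>?I ?Y - S ?Y \<epsilon>\<bar> \<le> C * K * \<epsilon> ^ n" by (intro bound e) auto
    moreover have "(C * K * (1 + p)) * norm (\<epsilon> ^ n) = p * (C * K * \<epsilon> ^ n) + C * K * \<epsilon> ^ n"
      using e by (simp add: algebra_simps)
    ultimately show ?thesis unfolding real_norm_def by linarith
  qed
  then show ?thesis
    by (intro bigoI[where c = "C * K * (1 + p)"]) (auto simp: eventually_at_filter intro!: always_eventually)
qed

text \<open>At lowest order the truncated equation says that the Gaussian mass to the left of \<open>Y \<epsilon>\<close> tends
  to the mass to the left of \<open>- L\<close>; the mass is strictly increasing in the end point.\<close>

lemma scaled_quantile_tendsto:
  assumes p: "0 < p" "p < 1"
  shows "((\<lambda>\<epsilon>. scaled_quantile p \<epsilon> + gauss_upper_quantile p) \<longlongrightarrow> 0) (at_right 0)"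
proof -
  define L where "L = gauss_upper_quantile p"
  define Y where "Y = scaled_quantile p"
  have "expands (nhds 0) 1 weight [:1:]"
    by (rule expands_agree[OF nhds_0_refl expands_mono[OF nhds_0_refl expands_weight_3]]) (auto simp: agree_def)
  from truncated_quantile_equation[OF p this]
  have "(\<lambda>\<epsilon>. gauss_moment 0 {..Y \<epsilon>} - p * gauss_moment 0 UNIV) \<in> O[at_right 0](\<lambda>\<epsilon>. \<epsilon>)" by (simp add: Y_def)
  then have "((\<lambda>\<epsilon>. gauss_moment 0 {..Y \<epsilon>} - p * gauss_moment 0 UNIV) \<longlongrightarrow> 0) (at_right 0)"
    by (rule bigo_tendsto_0) (rule tendsto_ident_at)
  from tendsto_add[OF this tendsto_const[of "p * gauss_moment 0 UNIV"]]
  have lim: "((\<lambda>\<epsilon>. gauss_moment 0 {..Y \<epsilon>}) \<longlongrightarrow> gauss_moment 0 {..- L}) (at_right 0)"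
    using gauss_moment_0_quantile[OF p] by (simp add: L_def)
  have mono: "a < b" if "gauss_moment 0 {..a} < gauss_moment 0 {..b}" for a b
    using that gauss_moment_0_strict_mono[of b a] by (cases a b rule: linorder_cases) auto
  have "((\<lambda>\<epsilon>. Y \<epsilon> + L) \<longlongrightarrow> 0) (at_right 0)"
  proof (rule order_tendstoI)
    fix a :: real assume "a < 0"
    then have "gauss_moment 0 {..- L + a} < gauss_moment 0 {..- L}" by (intro gauss_moment_0_strict_mono) simp
    from order_tendstoD(1)[OF lim this] show "\<forall>\<^sub>F \<epsilon> in at_right 0. a < Y \<epsilon> + L"
      by eventually_elim (drule mono, simp)
  next
    fix a :: real assume "a > 0"
    then have "gauss_moment 0 {..- L} < gauss_moment 0 {..- L + a}" by (intro gauss_moment_0_strict_mono) simp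
    from order_tendstoD(2)[OF lim this] show "\<forall>\<^sub>F \<epsilon> in at_right 0. Y \<epsilon> + L < a"
      by eventually_elim (drule mono, simp)
  qed
  then show ?thesis by (simp add: Y_def L_def)
qed

lemma ex_weight_polynomial:
  obtains P where "expands (nhds 0) (Suc n) weight P" "degree P \<le> Suc n" "coeff P 0 = 1"
proof -
  obtain q where q: "expands (nhds 0) (Suc n) weight q" using ex_expands_weight by blast
  define P where "P = (\<Sum>k<Suc n. monom (coeff q k) k)"
  have co: "coeff P k = (if k < Suc n then coeff q k else 0)" for k
    by (simp add: P_def coeff_sum del: sum.lessThan_Suc)
  have "expands (nhds 0) (Suc n) weight P" by (rule expands_agree[OF nhds_0_refl q]) (simp add: agree_def co)
  moreover have "degree P \<le> Suc n" by (rule degree_le) (simp add: co)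
  moreover have "coeff P 0 = 1"
    using expands_at_0[OF q] by (simp add: co weight_def defect_def poly_0_coeff_0)
  ultimately show ?thesis using that by blast
qed

text \<open>In the truncated equation the moments of order at least \<open>1\<close> come with a factor \<open>\<epsilon>\<close>, so their
  contribution \<open>\<epsilon> * R \<epsilon>\<close> is known to order \<open>n + 1\<close> once \<open>Z\<close> is known to order \<open>n\<close>. The moment of order \<open>0\<close>
  is therefore known to order \<open>n + 1\<close>, and it is inverted.\<close>

lemma expands_scaled_quantile_step:
  fixes p :: real
  defines "Z \<equiv> \<lambda>\<epsilon>. scaled_quantile p \<epsilon> + gauss_upper_quantile p"
  assumes p: "0 < p" "p < 1" and n: "n \<ge> 1" and q: "expands (at_right 0) n Z q"
  shows "\<exists>q'. expands (at_right 0) (Suc n) Z q'"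
proof -
  define a where "a = - gauss_upper_quantile p"
  define M where "M k = p * gauss_moment k UNIV" for k
  have Y: "scaled_quantile p \<epsilon> = a + Z \<epsilon>" for \<epsilon> by (simp add: Z_def a_def)
  have Z0: "(Z \<longlongrightarrow> 0) (at_right 0)" unfolding Z_def by (rule scaled_quantile_tendsto[OF p])
  have q0: "coeff q 0 = 0" using expands_coeff_0[OF _ Z0, of "n - 1" q] q n by simp
  define T where "T k \<epsilon> = gauss_moment k {..a + Z \<epsilon>} - M k" for k \<epsilon>
  have "\<exists>r. expands (at_right 0) n (T k) r" for k
  proof -
    obtain g where g: "expands (nhds 0) n (\<lambda>h. gauss_moment k {..a + h}) g" using ex_expands_gauss_moment by blast
    have "expands (at_right 0) n (\<lambda>\<epsilon>. gauss_moment k {..a + Z \<epsilon>}) (pcompose g q)"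
      by (rule expands_compose[OF at_right_0_le_nhds g q q0 n])
    from expands_diff[OF at_right_0_le_nhds this expands_const[OF at_right_0_le_nhds]] show ?thesis
      unfolding T_def by blast
  qed
  then obtain r where r: "\<And>k. expands (at_right 0) n (T k) (r k)" by metis
  obtain P where P: "expands (nhds 0) (Suc n) weight P" "degree P \<le> Suc n" "coeff P 0 = 1"
    using ex_weight_polynomial by blast
  define R where "R \<epsilon> = (\<Sum>i<degree P. coeff P (Suc i) * \<epsilon> ^ i * T (Suc i) \<epsilon>)" for \<epsilon>
  have "\<exists>s. expands (at_right 0) n R s"
  proof -
    have "expands (at_right 0) n R (\<Sum>i<degree P. [:coeff P (Suc i):] * monom 1 i * r (Suc i))"
      unfolding R_def
    proof (rule expands_sum[OF at_right_0_le_nhds])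
      fix i
      have "expands (at_right 0) n (\<lambda>\<epsilon>. \<epsilon> ^ i) (monom 1 i)"
        using expands_poly[OF at_right_0_le_nhds, of n "monom 1 i"] by (simp add: poly_monom[abs_def])
      then show "expands (at_right 0) n (\<lambda>\<epsilon>. coeff P (Suc i) * \<epsilon> ^ i * T (Suc i) \<epsilon>)
          ([:coeff P (Suc i):] * monom 1 i * r (Suc i))"
        by (intro expands_mult r expands_const at_right_0_le_nhds)
    qed
    then show ?thesis by blast
  qed
  then obtain s where s: "expands (at_right 0) n R s" by blast
  have eq: "(\<Sum>k\<le>degree P. coeff P k * \<epsilon> ^ k * T k \<epsilon>) = T 0 \<epsilon> - (- (\<epsilon> ^ 1 * R \<epsilon>))" for \<epsilon>
    by (simp add: sum.atMost_shift P(3) R_def sum_distrib_left mult_ac)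
  have "(\<lambda>\<epsilon>. T 0 \<epsilon> - (- (\<epsilon> ^ 1 * R \<epsilon>))) \<in> O[at_right 0](\<lambda>\<epsilon>. \<epsilon> ^ Suc n)"
    using truncated_quantile_equation[OF p P(1) _ P(2)] unfolding Y M_def[symmetric] T_def[symmetric] eq by simp
  moreover have "expands (at_right 0) (Suc n) (\<lambda>\<epsilon>. - (\<epsilon> ^ 1 * R \<epsilon>)) (- (monom 1 1 * s))"
    using expands_diff[OF at_right_0_le_nhds expands_const[OF at_right_0_le_nhds, of _ 0] expands_shift[OF at_right_0_le_nhds s, of 1]] by simp
  ultimately have T0: "expands (at_right 0) (Suc n) (T 0) (- (monom 1 1 * s))"
    unfolding expands_def by (rule bigo_diff_trans)
  obtain g where g: "coeff g 0 = gauss_moment 0 {..a}" "coeff g 1 = a ^ 0 * exp (- a\<^sup>2 / 2)"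
    "expands (nhds 0) (Suc n) (\<lambda>h. gauss_moment 0 {..a + h}) g" by (rule ex_expands_gauss_moment)
  have f: "expands (nhds 0) (Suc n) (\<lambda>h. gauss_moment 0 {..a + h} - M 0) (g - [:M 0:])"
    by (intro expands_diff expands_const nhds_0_refl g)
  have f0: "coeff (g - [:M 0:]) 0 = 0"
    using gauss_moment_0_quantile[OF p] by (simp add: g(1) a_def M_def)
  have f1: "coeff (g - [:M 0:]) 1 \<noteq> 0" using g(2) by simp
  obtain G where G: "agree (Suc n) (pcompose G (g - [:M 0:])) [:0, 1:]"
    using ex_compositional_inverse[OF f0 f1] by blast
  have "expands (at_right 0) (Suc n) Z (pcompose G (- (monom 1 1 * s)))"
    using T0 unfolding T_def
    by (intro expands_inverse[OF at_right_0_le_nhds f f0 f1 _ Z0 _ _ _ _ G]) (use n in \<open>auto simp: coeff_monom_mult\<close>)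
  then show ?thesis by blast
qed

lemma ex_expands_scaled_quantile:
  assumes p: "0 < p" "p < 1"
  shows "\<exists>q. expands (at_right 0) n (\<lambda>\<epsilon>. scaled_quantile p \<epsilon> + gauss_upper_quantile p) q"
proof -
  define a where "a = - gauss_upper_quantile p"
  define Z where "Z \<epsilon> = scaled_quantile p \<epsilon> + gauss_upper_quantile p" for \<epsilon>
  have base: "\<exists>q. expands (at_right 0) 1 Z q"
  proof -
    have "expands (nhds 0) 1 weight [:1:]"
      by (rule expands_agree[OF nhds_0_refl expands_mono[OF nhds_0_refl expands_weight_3]]) (auto simp: agree_def)
    from truncated_quantile_equation[OF p this]
    have T: "expands (at_right 0) 1 (\<lambda>\<epsilon>. gauss_moment 0 {..a + Z \<epsilon>} - p * gauss_moment 0 UNIV) 0"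
      by (simp add: expands_def Z_def a_def)
    obtain g where g: "coeff g 0 = gauss_moment 0 {..a}" "coeff g 1 = a ^ 0 * exp (- a\<^sup>2 / 2)"
      "expands (nhds 0) 2 (\<lambda>h. gauss_moment 0 {..a + h}) g" by (rule ex_expands_gauss_moment)
    let ?g = "g - [:p * gauss_moment 0 UNIV:]"
    have f: "expands (nhds 0) 2 (\<lambda>h. gauss_moment 0 {..a + h} - p * gauss_moment 0 UNIV) ?g"
      by (intro expands_diff expands_const nhds_0_refl g)
    have f0: "coeff ?g 0 = 0" using gauss_moment_0_quantile[OF p] by (simp add: g(1) a_def)
    have f1: "coeff ?g 1 \<noteq> 0" using g(2) by simp
    obtain G where G: "agree 1 (pcompose G ?g) [:0, 1:]"
      using ex_compositional_inverse[OF f0 f1] by blast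
    have Z0: "(Z \<longlongrightarrow> 0) (at_right 0)" unfolding Z_def by (rule scaled_quantile_tendsto[OF p])
    have "expands (at_right 0) 1 Z (pcompose G 0)"
      by (rule expands_inverse[OF at_right_0_le_nhds f f0 f1 _ Z0 T _ _ _ G]) auto
    then show ?thesis by blast
  qed
  have "\<exists>q. expands (at_right 0) (Suc n) Z q"
  proof (induction n)
    case (Suc n)
    then show ?case using expands_scaled_quantile_step[OF p, of "Suc n"] unfolding Z_def[abs_def] by auto
  qed (use base in simp)
  then show ?thesis using expands_mono[OF at_right_0_le_nhds, of "Suc n" _ _ n] unfolding Z_def[abs_def] by auto
qed

text \<open>Two unknown coefficients \<open>a\<close>, \<open>b\<close> of an expansion that exists are found by comparing the
  coefficients of \<open>\<epsilon>\<close> and \<open>\<epsilon>\<^sup>2\<close> in the equation truncated at order \<open>3\<close>.\<close>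

lemma expands_scaled_quantile_3:
  fixes p :: real
  defines "L \<equiv> gauss_upper_quantile p"
  assumes p: "0 < p" "p < 1"
  shows "expands (at_right 0) 3 (\<lambda>\<epsilon>. scaled_quantile p \<epsilon> + L) [:0, -1/3, - L / 36:]"
proof -
  define Z where "Z \<epsilon> = scaled_quantile p \<epsilon> + L" for \<epsilon>
  define \<phi> where "\<phi> = exp (- L\<^sup>2 / 2)"
  define M where "M k = p * gauss_moment k UNIV" for k
  define T where "T k \<epsilon> = gauss_moment k {..- L + Z \<epsilon>} - M k" for k \<epsilon>
  note r0 = at_right_0_le_nhds
  obtain q where q: "expands (at_right 0) 3 Z q"
    using ex_expands_scaled_quantile[OF p, of 3] by (auto simp: Z_def[abs_def] L_def)
  have Z0: "(Z \<longlongrightarrow> 0) (at_right 0)" unfolding Z_def L_def by (rule scaled_quantile_tendsto[OF p])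
  have q0: "coeff q 0 = 0" using expands_coeff_0[OF _ Z0, of 2 q] q by (simp add: numeral_3_eq_3)
  define a where "a = coeff q 1"
  define b where "b = coeff q 2"
  have Z3: "expands (at_right 0) 3 Z [:0, a, b:]"
    by (rule expands_agree[OF r0 q]) (simp add: agree_def q0 a_def b_def numeral_3_eq_3 less_Suc_eq numeral_2_eq_2)
  have gauss: "expands (nhds 0) 2 (\<lambda>h. exp (- (- L + h)\<^sup>2 / 2)) [:\<phi>, L * \<phi>:]"
    by (rule expands_agree[OF nhds_0_refl expands_gauss])
       (simp_all add: agree_def numeral_2_eq_2 less_Suc_eq \<phi>_def monom_altdef pcompose_pCons pcompose_add pcompose_1)
  have "expands (nhds 0) 3 (\<lambda>h. gauss_moment 0 {..- L + h}) [:M 0, \<phi>, L * \<phi> / 2:]"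
  proof -
    have "pderiv [:M 0, \<phi>, L * \<phi> / 2:] = [:\<phi>, L * \<phi>:]" by (simp add: pderiv_pCons)
    with gauss have "expands (nhds 0) 2 (\<lambda>h. (- L + h) ^ 0 * exp (- (- L + h)\<^sup>2 / 2))
        (pderiv [:M 0, \<phi>, L * \<phi> / 2:])" by (simp only: power_0 mult_1_left)
    from expands_gauss_moment[OF this] show ?thesis
      using gauss_moment_0_quantile[OF p] by (simp add: M_def L_def numeral_3_eq_3 numeral_2_eq_2)
  qed
  from expands_diff[OF nhds_0_refl this expands_const[OF nhds_0_refl, of _ "M 0"]]
  have "expands (nhds 0) 3 (\<lambda>h. gauss_moment 0 {..- L + h} - M 0) [:0, \<phi>, L * \<phi> / 2:]" by simp
  from expands_compose[OF r0 this Z3]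
  have T0: "expands (at_right 0) 3 (T 0) (pcompose [:0, \<phi>, L * \<phi> / 2:] [:0, a, b:])" by (simp add: T_def[abs_def])
  have gZ: "expands (at_right 0) 2 (\<lambda>\<epsilon>. exp (- (- L + Z \<epsilon>)\<^sup>2 / 2)) (pcompose [:\<phi>, L * \<phi>:] [:0, a, b:])"
    by (rule expands_compose[OF r0 gauss expands_mono[OF r0 Z3]]) auto
  have "expands (at_right 0) 2 (\<lambda>\<epsilon>. 0 - exp (- (- L + Z \<epsilon>)\<^sup>2 / 2)) ([:0:] - pcompose [:\<phi>, L * \<phi>:] [:0, a, b:])"
    by (intro expands_diff expands_const r0 gZ)
  then have T1: "expands (at_right 0) 2 (T 1) (- pcompose [:\<phi>, L * \<phi>:] [:0, a, b:])"
    by (simp add: T_def[abs_def] M_def gauss_moment_1[simplified] gauss_moment_1_UNIV[simplified])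
  have T2: "expands (at_right 0) 1 (T 2) [:L * \<phi>:]"
  proof -
    have "T 2 = (\<lambda>\<epsilon>. T 0 \<epsilon> - (- L + Z \<epsilon>) * exp (- (- L + Z \<epsilon>)\<^sup>2 / 2))"
      by (rule ext) (simp add: T_def M_def gauss_moment_2 gauss_moment_2_UNIV)
    moreover have "expands (at_right 0) 1 (\<lambda>\<epsilon>. T 0 \<epsilon> - (- L + Z \<epsilon>) * exp (- (- L + Z \<epsilon>)\<^sup>2 / 2))
        (pcompose [:0, \<phi>, L * \<phi> / 2:] [:0, a, b:] - ([:- L:] + [:0, a, b:]) * pcompose [:\<phi>, L * \<phi>:] [:0, a, b:])"
      by (intro expands_diff expands_mult expands_add expands_const r0 expands_mono[OF r0 T0]
            expands_mono[OF r0 Z3] expands_mono[OF r0 gZ]) auto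
    ultimately have "expands (at_right 0) 1 (T 2)
        (pcompose [:0, \<phi>, L * \<phi> / 2:] [:0, a, b:] - ([:- L:] + [:0, a, b:]) * pcompose [:\<phi>, L * \<phi>:] [:0, a, b:])"
      by (simp only:)
    then show ?thesis
      by (rule expands_agree[OF r0]) (simp add: agree_def pcompose_pCons)
  qed
  have "2 + 1 = (3::nat)" "1 + 2 = (3::nat)" by simp_all
  then have s1: "expands (at_right 0) 3 (\<lambda>\<epsilon>. \<epsilon> ^ 1 * T 1 \<epsilon>) (monom 1 1 * - pcompose [:\<phi>, L * \<phi>:] [:0, a, b:])"
    and s2: "expands (at_right 0) 3 (\<lambda>\<epsilon>. \<epsilon> ^ 2 * T 2 \<epsilon>) (monom 1 2 * [:L * \<phi>:])"
    using expands_shift[OF r0 T1, of 1] expands_shift[OF r0 T2, of 2] by (simp_all only:)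
  have "(\<lambda>\<epsilon>. T 0 \<epsilon> + (- 1 / 3) * (\<epsilon> ^ 1 * T 1 \<epsilon>) + (1 / 12) * (\<epsilon> ^ 2 * T 2 \<epsilon>)) \<in> O[at_right 0](\<lambda>\<epsilon>. \<epsilon> ^ 3)"
    using truncated_quantile_equation[OF p expands_weight_3]
    by (simp add: T_def M_def Z_def numeral_2_eq_2 mult_ac)
  then have "expands (at_right 0) 3 (\<lambda>\<epsilon>. T 0 \<epsilon> + (- 1 / 3) * (\<epsilon> ^ 1 * T 1 \<epsilon>) + (1 / 12) * (\<epsilon> ^ 2 * T 2 \<epsilon>)) 0"
    by (simp add: expands_def)
  moreover have "expands (at_right 0) 3 (\<lambda>\<epsilon>. T 0 \<epsilon> + (- 1 / 3) * (\<epsilon> ^ 1 * T 1 \<epsilon>) + (1 / 12) * (\<epsilon> ^ 2 * T 2 \<epsilon>))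
    (pcompose [:0, \<phi>, L * \<phi> / 2:] [:0, a, b:] + [:- 1 / 3:] * (monom 1 1 * - pcompose [:\<phi>, L * \<phi>:] [:0, a, b:])
      + [:1 / 12:] * (monom 1 2 * [:L * \<phi>:]))"
    by (rule expands_add[OF r0 expands_add[OF r0 T0 expands_mult[OF r0 expands_const[OF r0] s1]]
          expands_mult[OF r0 expands_const[OF r0] s2]])
  ultimately have ag: "agree 3 0 (pcompose [:0, \<phi>, L * \<phi> / 2:] [:0, a, b:] + [:- 1 / 3:] * (monom 1 1 * - pcompose [:\<phi>, L * \<phi>:] [:0, a, b:])
      + [:1 / 12:] * (monom 1 2 * [:L * \<phi>:]))"
    by (rule expands_unique[OF r0 order_refl])
  have phi: "\<phi> \<noteq> 0" by (simp add: \<phi>_def)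
  have "a * \<phi> + \<phi> / 3 = 0" "b * \<phi> + L * \<phi> / 2 * a\<^sup>2 + L * \<phi> * a / 3 + L * \<phi> / 12 = 0"
    using ag[unfolded agree_def, rule_format, of 1] ag[unfolded agree_def, rule_format, of 2]
    by (simp_all add: pcompose_pCons monom_altdef numeral_2_eq_2 algebra_simps)
  then have "\<phi> * (a + 1 / 3) = 0" "\<phi> * (b + L / 2 * a\<^sup>2 + L * a / 3 + L / 12) = 0"
    by (simp_all add: algebra_simps)
  then have "a = - 1 / 3" and b': "b + L / 2 * a\<^sup>2 + L * a / 3 + L / 12 = 0" using phi by simp_all
  moreover have "b = - L / 36" using b' unfolding \<open>a = - 1 / 3\<close> by (simp add: power2_eq_square)
  ultimately show ?thesis using Z3 by (simp add: Z_def[abs_def])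
qed

lemma expands_quantile:
  fixes p :: real
  defines "L \<equiv> gauss_upper_quantile p"
  assumes p: "0 < p" "p < 1"
    and q: "expands (at_right 0) n (\<lambda>\<epsilon>. scaled_quantile p \<epsilon> + L) q"
    and w: "expands (nhds 0) (Suc n) eta_inv r"
  shows "expands (at_right 0) (Suc n) (\<lambda>\<epsilon>. \<epsilon>\<^sup>2 * gamma_quantile p (1 / \<epsilon>\<^sup>2))
           ([:1:] + pcompose r (monom 1 1 * (q - [:L:])))"
proof -
  have "expands (at_right 0) n (scaled_quantile p) (q - [:L:])"
    using expands_diff[OF at_right_0_le_nhds q expands_const[OF at_right_0_le_nhds, of _ L]] by simp
  from expands_shift[OF at_right_0_le_nhds this, of 1]
  have "expands (at_right 0) (Suc n) (\<lambda>\<epsilon>. \<epsilon> ^ 1 * scaled_quantile p \<epsilon>) (monom 1 1 * (q - [:L:]))" by simp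
  from expands_compose[OF at_right_0_le_nhds w this]
  have "expands (at_right 0) (Suc n) (\<lambda>\<epsilon>. eta_inv (\<epsilon> ^ 1 * scaled_quantile p \<epsilon>)) (pcompose r (monom 1 1 * (q - [:L:])))"
    by (simp add: coeff_monom_mult)
  from expands_add[OF at_right_0_le_nhds expands_const[OF at_right_0_le_nhds, of _ 1] this]
  have *: "expands (at_right 0) (Suc n) (\<lambda>\<epsilon>. 1 + eta_inv (\<epsilon> ^ 1 * scaled_quantile p \<epsilon>))
           ([:1:] + pcompose r (monom 1 1 * (q - [:L:])))" .
  have eq: "1 + eta_inv (\<epsilon> ^ 1 * scaled_quantile p \<epsilon>) = \<epsilon>\<^sup>2 * gamma_quantile p (1 / \<epsilon>\<^sup>2)" if "\<epsilon> > 0" for \<epsilon>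
  proof -
    have "gamma_quantile p (1 / \<epsilon>\<^sup>2) > 0"
      using is_gamma_quantile_gamma_quantile[OF p, of "1 / \<epsilon>\<^sup>2"] that by (simp add: is_gamma_quantile_def)
    then have "\<epsilon>\<^sup>2 * gamma_quantile p (1 / \<epsilon>\<^sup>2) - 1 > - 1" using that by simp
    then show ?thesis using that by (simp add: scaled_quantile_def)
  qed
  have "\<forall>\<^sub>F \<epsilon> in at_right 0. 1 + eta_inv (\<epsilon> ^ 1 * scaled_quantile p \<epsilon>) = \<epsilon>\<^sup>2 * gamma_quantile p (1 / \<epsilon>\<^sup>2)"
    using eventually_at_right_less[of 0] by eventually_elim (rule eq)
  then have "\<forall>\<^sub>F \<epsilon> in at_right 0. 1 + eta_inv (\<epsilon> ^ 1 * scaled_quantile p \<epsilon>) - poly ([:1:] + pcompose r (monom 1 1 * (q - [:L:]))) \<epsilon>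
      = \<epsilon>\<^sup>2 * gamma_quantile p (1 / \<epsilon>\<^sup>2) - poly ([:1:] + pcompose r (monom 1 1 * (q - [:L:]))) \<epsilon>"
    by eventually_elim (simp only:)
  from landau_o.big.in_cong[OF this] * show ?thesis unfolding expands_def by blast
qed

text \<open>With \<open>\<epsilon> = x powr (-1/2)\<close> the function \<open>f x\<close> is \<open>1 / \<epsilon>\<^sup>2\<close> times the expanded one; this shifts
  the indices by \<open>2\<close>, so the sum up to \<open>N\<close> uses the expansion of order \<open>n = N + 3\<close>.\<close>

lemma has_half_power_expansionI:
  fixes c :: "nat \<Rightarrow> real"
  assumes "\<And>n. expands (at_right 0) n (\<lambda>\<epsilon>. \<epsilon>\<^sup>2 * f (1 / \<epsilon>\<^sup>2)) (\<Sum>k<n. monom (c k) k)"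
  shows "has_half_power_expansion f (-2) (\<lambda>i. c (nat (i + 2)))"
  unfolding has_half_power_expansion_def
proof (intro allI impI)
  fix N :: int assume N: "-2 \<le> N"
  define n where "n = nat (N + 3)"
  have Nn: "N = int n - 3" using N by (simp add: n_def)
  have lim: "filterlim (\<lambda>x::real. x powr (-1/2)) (at_right 0) at_top" by real_asymp
  from assms[of n] have "(\<lambda>x. (x powr (-1/2))\<^sup>2 * f (1 / (x powr (-1/2))\<^sup>2) - poly (\<Sum>k<n. monom (c k) k) (x powr (-1/2)))
      \<in> O[at_top](\<lambda>x. (x powr (-1/2)) ^ n)"
    unfolding expands_def by (rule landau_o.big.compose[OF _ lim])
  then have bigo: "(\<lambda>x. x * ((x powr (-1/2))\<^sup>2 * f (1 / (x powr (-1/2))\<^sup>2) - poly (\<Sum>k<n. monom (c k) k) (x powr (-1/2))))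
      \<in> O[at_top](\<lambda>x. x * (x powr (-1/2)) ^ n)"
    by (rule landau_o.big.mult[OF landau_o.big_refl])
  have terms: "\<forall>\<^sub>F x in at_top. x * ((x powr (-1/2))\<^sup>2 * f (1 / (x powr (-1/2))\<^sup>2) - poly (\<Sum>k<n. monom (c k) k) (x powr (-1/2)))
      = f x - (\<Sum>i = -2..N. c (nat (i + 2)) / x powr (of_int i / 2))"
    using eventually_gt_at_top[of 0]
  proof eventually_elim
    case (elim x)
    have e: "(x powr (-1/2)) ^ k = x powr (- real k / 2)" for k
      using elim by (simp add: powr_realpow[symmetric] powr_powr)
    have e2: "(x powr (-1/2))\<^sup>2 = 1 / x" by (simp only: e) (use elim in \<open>simp add: powr_minus_divide\<close>)
    have "x * poly (\<Sum>k<n. monom (c k) k) (x powr (-1/2)) = (\<Sum>k<n. c k / x powr (of_int (int k - 2) / 2))"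
      unfolding poly_sum poly_monom sum_distrib_left
    proof (rule sum.cong)
      fix k
      have "x * x powr (- real k / 2) = x powr (1 - real k / 2)"
        using elim by (simp add: powr_diff powr_minus_divide)
      also have "1 - real k / 2 = - (of_int (int k - 2) / 2)" by (simp add: field_simps)
      also have "x powr \<dots> = 1 / x powr (of_int (int k - 2) / 2)" by (rule powr_minus_divide)
      finally show "x * (c k * (x powr (-1/2)) ^ k) = c k / x powr (of_int (int k - 2) / 2)"
        by (simp only: e mult.left_commute[of x] times_divide_eq_right mult_1_right)
    qed simp
    also have "\<dots> = (\<Sum>i = -2..N. c (nat (i + 2)) / x powr (of_int i / 2))"
      by (rule sum.reindex_bij_witness[of _ "\<lambda>i. nat (i + 2)" "\<lambda>k. int k - 2"]) (auto simp: Nn)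
    finally show ?case using elim unfolding e2 right_diff_distrib by simp
  qed
  have bound: "\<forall>\<^sub>F x::real in at_top. x * (x powr (-1/2)) ^ n = x powr (- (of_int N + 1) / 2)"
    using eventually_gt_at_top[of 0]
  proof eventually_elim
    case (elim x)
    have "x * (x powr (-1/2)) ^ n = x powr 1 * x powr (- real n / 2)"
      using elim by (simp add: powr_realpow[symmetric] powr_powr)
    also have "\<dots> = x powr (1 + - real n / 2)" by (rule powr_add[symmetric])
    also have "1 + - real n / 2 = - (of_int N + 1) / 2" by (simp add: Nn field_simps)
    finally show ?case .
  qed
  show "(\<lambda>x. f x - (\<Sum>i = -2..N. c (nat (i + 2)) / x powr (of_int i / 2)))
        \<in> O[at_top](\<lambda>x. x powr (- (of_int N + 1) / 2))"
    using landau_o.big.in_cong[OF terms, THEN iffD1, OF bigo] by (simp only: landau_o.big.cong[OF bound])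
qed

theorem theoremA6:
  fixes p :: real
  assumes "0 < p" and "p < 1"
  defines "L \<equiv> gauss_upper_quantile p"
  shows "\<exists>\<tau> :: int \<Rightarrow> real.
           has_half_power_expansion (gamma_quantile p) (-2) \<tau> \<and>
           \<tau> (-2) = 1 \<and>
           \<tau> (-1) = - L \<and>
           \<tau> 0 = (L\<^sup>2 - 1) / 3 \<and>
           \<tau> 1 = L * (7 - L\<^sup>2) / 36"
proof -
  let ?W = "\<lambda>\<epsilon>. \<epsilon>\<^sup>2 * gamma_quantile p (1 / \<epsilon>\<^sup>2)"
  have "\<exists>w. expands (at_right 0) n ?W w" for n
  proof -
    obtain q where "expands (at_right 0) n (\<lambda>\<epsilon>. scaled_quantile p \<epsilon> + gauss_upper_quantile p) q"
      using ex_expands_scaled_quantile[OF assms(1,2)] by blast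
    moreover obtain r where "expands (nhds 0) (Suc n) eta_inv r" using ex_expands_eta_inv by blast
    ultimately show ?thesis
      using expands_mono[OF at_right_0_le_nhds expands_quantile[OF assms(1,2)], of n _ _ n] by auto
  qed
  then obtain w where w: "\<And>n. expands (at_right 0) n ?W (w n)" by metis
  define c where "c k = coeff (w (Suc k)) k" for k
  have agree_c: "coeff v k = c k" if "expands (at_right 0) n ?W v" "k < n" for n v k
  proof -
    have "expands (at_right 0) (Suc k) ?W v" using expands_mono[OF at_right_0_le_nhds that(1)] that(2) by simp
    from expands_unique[OF at_right_0_le_nhds order_refl this w] show ?thesis by (simp add: agree_def c_def)
  qed
  have "expands (at_right 0) n ?W (\<Sum>k<n. monom (c k) k)" for n
    by (rule expands_agree[OF at_right_0_le_nhds w[of n]]) (simp add: agree_def coeff_sum agree_c[OF w])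
  then have "has_half_power_expansion (gamma_quantile p) (-2) (\<lambda>i. c (nat (i + 2)))"
    by (rule has_half_power_expansionI)
  moreover
  have W4: "expands (at_right 0) 4 ?W ([:1:] + pcompose [:0, 1, 1/3, 1/36:] (monom 1 1 * ([:0, -1/3, - L / 36:] - [:L:])))"
    using expands_quantile[OF assms(1,2) expands_scaled_quantile_3[OF assms(1,2)], of "[:0, 1, 1/3, 1/36:]"] expands_eta_inv_4
    by (simp add: L_def)
  note coeffs = monom_altdef pcompose_pCons numeral_2_eq_2 numeral_3_eq_3 field_simps power2_eq_square
  have "c 0 = 1" using agree_c[OF W4, of 0] by (simp add: coeffs)
  moreover have "c 1 = - L" using agree_c[OF W4, of 1] by (simp add: coeffs)
  moreover have "c 2 = (L\<^sup>2 - 1) / 3" using agree_c[OF W4, of 2] by (simp add: coeffs)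
  moreover have "c 3 = L * (7 - L\<^sup>2) / 36" using agree_c[OF W4, of 3] by (simp add: coeffs)
  ultimately show ?thesis by (intro exI[of _ "\<lambda>i. c (nat (i + 2))"]) simp
qed

end
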